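(* Let $q$ be a quasigeodesic in a geodesic metric space $X$. Then $q$ is stable if and only if $q$ is middle recurrent. Moreover, its recurrence function can be bounded from above only in terms of its stability function, and vice versa.
   Context: A path is a continuous map from an interval into $X$. For a finite path $p$, $\|p\|$ denotes its arclength. For a subset $Y\subset X$ and $r\ge0$, $N_r(Y)$ is the $r$-neighborhood of $Y$ in $X$. For $\kappa\ge1$ and $\lambda>0$, a $(\kappa,\lambda)$-quasigeodesic is a map $\gamma\colon I\to X$ from an interval (possibly infinitely long) such that $\frac1\kappa|s-s'|-\lambda\le d(\gamma(s),\gamma(s'))\le\kappa|s-s'|+\lambda$ for all $s,s'\in I$. A quasigeodesic is a $(\kappa,\lambda)$-quasigeodesic for some $\kappa,\lambda$. A quasigeodesic is often identified with its image; $a\in\gamma$ means that $a$ is in the image of $\gamma$. Stability: for a function $D\colon\mathbb{R}_{\ge0}^2\to\mathbb{R}_{\ge0}$, a quasigeodesic $\gamma$ in $X$ is $D$-stable if any $(\kappa,\lambda)$-quasigeodesic with endpoints on $\gamma$ remains within the $D(\kappa,\lambda)$-neighborhood of $\gamma$; $D$ is then called a stability function of $\gamma$. The quasigeodesic $\gamma$ is stable if it is $D$-stable for some $D$. Middle recurrence: for $a,b\in\gamma$, a point $x\in\gamma$ lies between $a$ and $b$ if there are $s_1\le s_2\le s_3$ in the domain of $\gamma$ with $\gamma(s_1)=a$, $\gamma(s_2)=x$, $\gamma(s_3)=b$. For $t\in(0,1/2)$, the $t$-middle $\gamma_{\mathbf t[a,b]}$ is the set of $x\in\gamma$ lying between $a$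 and $b$ such that $\min\{d(x,a),d(x,b)\}\ge t\cdot d(a,b)$. The path or quasigeodesic $\gamma$ is $t$-middle recurrent if there is a function $\mathfrak m_{t,\gamma}\colon\mathbb{R}_+\to\mathbb{R}_+$, called the $t$-recurrence function of $\gamma$, such that for every $C$ and any path $p$ with endpoints $a,b\in\gamma$ (labelled according to the orientation of $\gamma$) satisfying $\|p\|\le C\cdot d(a,b)$, we have $p\cap N_{\mathfrak m_{t,\gamma}(C)}(\gamma_{\mathbf t[a,b]})\neq\emptyset$. It is middle recurrent if it is $t$-middle recurrent for each $t\in(0,1/2)$.
   Formalization: For stable ⇒ middle recurrent, q is assumed continuous (the floor map is a counterexample otherwise), and the recurrence bound may also depend on q's constants κ, λ (false without, by a circle with a ray). Bounds are uniform over spaces in one arbitrary carrier type. *)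

theory Defs
  imports "HOL-Analysis.Analysis"
begin

text \<open>Metric spaces are given by a carrier \<open>M\<close> and a distance \<open>d\<close> (locale
  \<^locale>\<open>Metric_space\<close>) rather than by the type class, so that bounds which must not depend on the
  space can be stated by quantifying over \<open>M\<close> and \<open>d\<close> inside a formula.\<close>

definition geodesic_space :: "'a set \<Rightarrow> ('a \<Rightarrow> 'a \<Rightarrow> real) \<Rightarrow> bool" where
  "geodesic_space M d \<longleftrightarrow> Metric_space M d \<and>
     (\<forall>x\<in>M. \<forall>y\<in>M. \<exists>g. g ` {0..d x y} \<subseteq> M \<and> g 0 = x \<and> g (d x y) = y \<and>
        (\<forall>s\<in>{0..d x y}. \<forall>s'\<in>{0..d x y}. d (g s) (g s') = \<bar>s - s'\<bar>))"

text \<open>The neighbourhood is closed, so that the radius \<open>r = 0\<close> is meaningful; it is empty if \<open>Y\<close> is.\<close>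

definition nbhd :: "'a set \<Rightarrow> ('a \<Rightarrow> 'a \<Rightarrow> real) \<Rightarrow> real \<Rightarrow> 'a set \<Rightarrow> 'a set" where
  "nbhd M d r Y = {x \<in> M. \<exists>y\<in>Y. d x y \<le> r}"

definition continuous_path :: "'a set \<Rightarrow> ('a \<Rightarrow> 'a \<Rightarrow> real) \<Rightarrow> real set \<Rightarrow> (real \<Rightarrow> 'a) \<Rightarrow> bool" where
  "continuous_path M d I p \<longleftrightarrow> is_interval I \<and>
     continuous_map (top_of_set I) (Metric_space.mtopology M d) p"

definition arclength :: "('a \<Rightarrow> 'a \<Rightarrow> real) \<Rightarrow> real \<Rightarrow> real \<Rightarrow> (real \<Rightarrow> 'a) \<Rightarrow> ennreal" where
  "arclength d u v p =
     Sup {\<Sum>i<n. ennreal (d (p (x i)) (p (x (Suc i)))) | (n::nat) (x::nat \<Rightarrow> real).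
            x 0 = u \<and> x n = v \<and> (\<forall>i<n. x i \<le> x (Suc i))}"

text \<open>Quasigeodesics need not be continuous. A stable quasigeodesic with jumps can fail to be middle
  recurrent: \<open>floor\<close> on the reals is stable, but its \<open>t\<close>-middle between \<open>0\<close> and \<open>1\<close> is empty. Continuity
  is therefore a separate assumption where it is needed.\<close>

definition quasigeodesic ::
  "'a set \<Rightarrow> ('a \<Rightarrow> 'a \<Rightarrow> real) \<Rightarrow> real \<Rightarrow> real \<Rightarrow> real set \<Rightarrow> (real \<Rightarrow> 'a) \<Rightarrow> bool" where
  "quasigeodesic M d \<kappa> L I \<gamma> \<longleftrightarrow> \<kappa> \<ge> 1 \<and> L > 0 \<and> is_interval I \<and> \<gamma> ` I \<subseteq> M \<and>
     (\<forall>s\<in>I. \<forall>s'\<in>I. \<bar>s - s'\<bar> / \<kappa> - L \<le> d (\<gamma> s) (\<gamma> s') \<and> d (\<gamma> s) (\<gamma> s') \<le> \<kappa> * \<bar>s - s'\<bar> + L)"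

definition is_quasigeodesic :: "'a set \<Rightarrow> ('a \<Rightarrow> 'a \<Rightarrow> real) \<Rightarrow> real set \<Rightarrow> (real \<Rightarrow> 'a) \<Rightarrow> bool" where
  "is_quasigeodesic M d I \<gamma> \<longleftrightarrow> (\<exists>\<kappa> L. quasigeodesic M d \<kappa> L I \<gamma>)"

definition stable_with ::
  "'a set \<Rightarrow> ('a \<Rightarrow> 'a \<Rightarrow> real) \<Rightarrow> (real \<Rightarrow> real \<Rightarrow> real) \<Rightarrow> real set \<Rightarrow> (real \<Rightarrow> 'a) \<Rightarrow> bool" where
  "stable_with M d D I \<gamma> \<longleftrightarrow>
     (\<forall>\<kappa>\<ge>0. \<forall>L\<ge>0. D \<kappa> L \<ge> 0) \<and>
     (\<forall>\<kappa> L u v \<eta>. u \<le> v \<longrightarrow> quasigeodesic M d \<kappa> L {u..v} \<eta> \<longrightarrow> \<eta> u \<in> \<gamma> ` I \<longrightarrow> \<eta> v \<in> \<gamma> ` I \<longrightarrow>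
        \<eta> ` {u..v} \<subseteq> nbhd M d (D \<kappa> L) (\<gamma> ` I))"

definition stable_quasigeodesic :: "'a set \<Rightarrow> ('a \<Rightarrow> 'a \<Rightarrow> real) \<Rightarrow> real set \<Rightarrow> (real \<Rightarrow> 'a) \<Rightarrow> bool" where
  "stable_quasigeodesic M d I \<gamma> \<longleftrightarrow> (\<exists>D. stable_with M d D I \<gamma>)"

definition lies_between :: "real set \<Rightarrow> (real \<Rightarrow> 'a) \<Rightarrow> 'a \<Rightarrow> 'a \<Rightarrow> 'a \<Rightarrow> bool" where
  "lies_between I \<gamma> a x b \<longleftrightarrow>
     (\<exists>s\<^sub>1\<in>I. \<exists>s\<^sub>2\<in>I. \<exists>s\<^sub>3\<in>I. s\<^sub>1 \<le> s\<^sub>2 \<and> s\<^sub>2 \<le> s\<^sub>3 \<and> \<gamma> s\<^sub>1 = a \<and> \<gamma> s\<^sub>2 = x \<and> \<gamma> s\<^sub>3 = b)"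

definition t_middle ::
  "('a \<Rightarrow> 'a \<Rightarrow> real) \<Rightarrow> real set \<Rightarrow> (real \<Rightarrow> 'a) \<Rightarrow> real \<Rightarrow> 'a \<Rightarrow> 'a \<Rightarrow> 'a set" where
  "t_middle d I \<gamma> t a b =
     {x \<in> \<gamma> ` I. lies_between I \<gamma> a x b \<and> min (d x a) (d x b) \<ge> t * d a b}"

text \<open>The points \<open>a\<close>, \<open>b\<close> are labelled by the orientation of \<open>\<gamma>\<close> (if \<open>\<gamma>\<close> is not injective, both
  labellings may be admissible); \<open>p\<close> may run from \<open>a\<close> to \<open>b\<close> or from \<open>b\<close> to \<open>a\<close>.\<close>

definition recurrent_with ::
  "'a set \<Rightarrow> ('a \<Rightarrow> 'a \<Rightarrow> real) \<Rightarrow> real \<Rightarrow> (real \<Rightarrow> real) \<Rightarrow> real set \<Rightarrow> (real \<Rightarrow> 'a) \<Rightarrow> bool" where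
  "recurrent_with M d t m I \<gamma> \<longleftrightarrow>
     (\<forall>C>0. m C > 0) \<and>
     (\<forall>C>0. \<forall>p u v a b. u \<le> v \<longrightarrow> continuous_path M d {u..v} p \<longrightarrow>
        (p u = a \<and> p v = b) \<or> (p u = b \<and> p v = a) \<longrightarrow>
        (\<exists>s\<in>I. \<exists>s'\<in>I. s \<le> s' \<and> \<gamma> s = a \<and> \<gamma> s' = b) \<longrightarrow>
        arclength d u v p \<le> ennreal (C * d a b) \<longrightarrow>
        p ` {u..v} \<inter> nbhd M d (m C) (t_middle d I \<gamma> t a b) \<noteq> {})"

definition t_middle_recurrent ::
  "'a set \<Rightarrow> ('a \<Rightarrow> 'a \<Rightarrow> real) \<Rightarrow> real \<Rightarrow> real set \<Rightarrow> (real \<Rightarrow> 'a) \<Rightarrow> bool" where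
  "t_middle_recurrent M d t I \<gamma> \<longleftrightarrow> (\<exists>m. recurrent_with M d t m I \<gamma>)"

definition middle_recurrent :: "'a set \<Rightarrow> ('a \<Rightarrow> 'a \<Rightarrow> real) \<Rightarrow> real set \<Rightarrow> (real \<Rightarrow> 'a) \<Rightarrow> bool" where
  "middle_recurrent M d I \<gamma> \<longleftrightarrow> (\<forall>t\<in>{0<..<1/2}. t_middle_recurrent M d t I \<gamma>)"

end

theory Submission
  imports Defs
begin

text \<open>Stable implies recurrent: give weight \<open>K\<close> to the points of a large neighbourhood of the
  \<open>t\<close>-middle and weight \<open>1\<close> to all others. A walk with unit steps of least total weight from \<open>a\<close> to
  \<open>b\<close> is a \<open>(K, 2)\<close>-quasigeodesic, so by stability it stays close to \<open>q\<close>, hence it has to follow the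
  middle of \<open>q\<close> and weighs about \<open>K (1 - 2t) d(a,b)\<close> or more. A path of length \<open>C d(a,b)\<close> that avoids
  the neighbourhood would give a walk of weight about \<open>2 C d(a,b)\<close>, which is too cheap if
  \<open>K (1 - 2t) \<ge> 3C\<close> and \<open>d(a,b)\<close> is large. If \<open>d(a,b)\<close> is bounded, the middle, which is nonempty by
  continuity, is close to \<open>a\<close>.

  Recurrent implies stable: join the ends of a long excursion of a quasigeodesic away from \<open>q\<close> to \<open>q\<close>.
  The resulting path has length at most \<open>C d(a,b)\<close>, but only its short end segments can come close to
  \<open>q\<close>, so some point of the middle is close to \<open>a\<close> or \<open>b\<close>. This bounds \<open>d(a,b)\<close> and hence the length
  of the excursion. One value of \<open>t\<close> suffices, and the constants of \<open>q\<close> play no role.\<close>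

subsection \<open>Paths\<close>

lemma continuous_path_iff:
  assumes "Metric_space M d"
  shows "continuous_path M d I p \<longleftrightarrow> is_interval I \<and> p ` I \<subseteq> M \<and>
    (\<forall>s\<in>I. \<forall>e>0. \<exists>\<delta>>0. \<forall>s'\<in>I. \<bar>s' - s\<bar> < \<delta> \<longrightarrow> d (p s) (p s') < e)"
proof -
  interpret Metric_space M d by fact
  have "continuous_map (top_of_set I) mtopology p \<longleftrightarrow> p ` I \<subseteq> M \<and>
    (\<forall>s\<in>I. \<forall>e>0. \<exists>\<delta>>0. \<forall>s'\<in>I. \<bar>s' - s\<bar> < \<delta> \<longrightarrow> d (p s) (p s') < e)" (is "?L \<longleftrightarrow> ?R")
  proof
    assume L: ?L
    have "\<exists>\<delta>>0. \<forall>s'\<in>I. \<bar>s' - s\<bar> < \<delta> \<longrightarrow> d (p s) (p s') < e" if s: "s \<in> I" "e > 0" for s e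
    proof -
      obtain U where U: "openin (top_of_set I) U" "s \<in> U" "\<forall>y\<in>U. p y \<in> mball (p s) e"
        using L[unfolded continuous_map_to_metric, rule_format, of s e] s by auto
      then obtain \<delta> where "\<delta> > 0" "\<forall>s'\<in>I. dist s' s < \<delta> \<longrightarrow> s' \<in> U"
        unfolding openin_euclidean_subtopology_iff by meson
      moreover have "d (p s) (p y) < e" if "y \<in> U" for y using U(3) that by (simp add: in_mball)
      ultimately show ?thesis unfolding dist_real_def by blast
    qed
    moreover have "p ` I \<subseteq> M" using continuous_map_image_subset_topspace[OF L] by simp
    ultimately show ?R by blast
  next
    assume R: ?R
    show ?L unfolding continuous_map_to_metric
    proof (intro ballI allI impI)
      fix s and e :: real assume s: "s \<in> topspace (top_of_set I)" "e > 0"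
      then obtain \<delta> where \<delta>: "\<delta> > 0" "\<forall>s'\<in>I. \<bar>s' - s\<bar> < \<delta> \<longrightarrow> d (p s) (p s') < e"
        using conjunct2[OF R, rule_format, of s e] by auto
      have "openin (top_of_set I) (I \<inter> ball s \<delta>)" by (simp add: openin_open_Int)
      moreover have "s \<in> I \<inter> ball s \<delta>" using s \<delta> by simp
      moreover have "\<forall>y\<in>I \<inter> ball s \<delta>. p y \<in> mball (p s) e"
        using s \<delta>(2) conjunct1[OF R] by (simp add: in_mball dist_real_def abs_minus_commute image_subset_iff)
      ultimately show "\<exists>U. openin (top_of_set I) U \<and> s \<in> U \<and> (\<forall>y\<in>U. p y \<in> mball (p s) e)"
        by blast
    qed
  qed
  then show ?thesis by (simp add: continuous_path_def)
qed

lemma partition_mono: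
  fixes x :: "nat \<Rightarrow> 'b::preorder"
  assumes "\<forall>i<n. x i \<le> x (Suc i)" "i \<le> j" "j \<le> n"
  shows "x i \<le> x j"
  using assms(2,3)
proof (induction j rule: dec_induct)
  case (step j)
  then show ?case using assms(1) by (meson Suc_leD Suc_le_lessD order_trans)
qed simp

lemma lipschitz_path:
  assumes "Metric_space M d" "u \<le> v" "p ` {u..v} \<subseteq> M"
    and lip: "\<And>s s'. s \<in> {u..v} \<Longrightarrow> s' \<in> {u..v} \<Longrightarrow> d (p s) (p s') \<le> \<bar>s - s'\<bar>"
  shows "continuous_path M d {u..v} p" "arclength d u v p \<le> ennreal (v - u)"
proof -
  show "continuous_path M d {u..v} p"
    unfolding continuous_path_iff[OF assms(1)]
  proof (intro conjI ballI allI impI)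
    fix s and e :: real assume s: "s \<in> {u..v}" "e > 0"
    have "d (p s) (p s') < e" if "s' \<in> {u..v}" "\<bar>s' - s\<bar> < e" for s'
      using lip[OF s(1) that(1)] that(2) by simp
    then show "\<exists>\<delta>>0. \<forall>s'\<in>{u..v}. \<bar>s' - s\<bar> < \<delta> \<longrightarrow> d (p s) (p s') < e"
      using s by blast
  qed (use assms in \<open>auto simp: is_interval_cc\<close>)
  show "arclength d u v p \<le> ennreal (v - u)"
    unfolding arclength_def
  proof (rule Sup_least, clarify)
    fix n and x :: "nat \<Rightarrow> real"
    assume x: "u = x 0" "v = x n" "\<forall>i<n. x i \<le> x (Suc i)"
    have "(\<Sum>i<n. ennreal (d (p (x i)) (p (x (Suc i))))) \<le> (\<Sum>i<n. ennreal (x (Suc i) - x i))"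
    proof (rule sum_mono)
      fix i assume i: "i \<in> {..<n}"
      have "x i \<in> {u..v}" "x (Suc i) \<in> {u..v}"
        using x i partition_mono[of n x] by auto
      then have "d (p (x i)) (p (x (Suc i))) \<le> \<bar>x i - x (Suc i)\<bar>" by (rule lip)
      then show "ennreal (d (p (x i)) (p (x (Suc i)))) \<le> ennreal (x (Suc i) - x i)"
        using x i by (intro ennreal_leI) auto
    qed
    also have "\<dots> = ennreal (\<Sum>i<n. x (Suc i) - x i)"
      using x by (intro sum_ennreal) auto
    also have "(\<Sum>i<n. x (Suc i) - x i) = x n - x 0" by (rule sum_lessThan_telescope)
    finally show "(\<Sum>i<n. ennreal (d (p (x i)) (p (x (Suc i))))) \<le> ennreal (x n - x 0)" .
  qed
qed

lemma geodesicE: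
  assumes "geodesic_space M d" "x \<in> M" "y \<in> M"
  obtains g where "g ` {0..d x y} \<subseteq> M" "g 0 = x" "g (d x y) = y"
    "\<And>s s'. s \<in> {0..d x y} \<Longrightarrow> s' \<in> {0..d x y} \<Longrightarrow> d (g s) (g s') = \<bar>s - s'\<bar>"
proof -
  from assms obtain g where "g ` {0..d x y} \<subseteq> M \<and> g 0 = x \<and> g (d x y) = y \<and>
      (\<forall>s\<in>{0..d x y}. \<forall>s'\<in>{0..d x y}. d (g s) (g s') = \<bar>s - s'\<bar>)"
    unfolding geodesic_space_def by blast
  then show thesis by (intro that[of g]) simp_all
qed

text \<open>Geodesics parametrised by arclength are appended one at a time; a distance across a
  junction is estimated through the junction point. Equality in the triangle inequality records on
  which segment a point lies. The alternative \<open>p s = x 0\<close> covers \<open>n = 0\<close>,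
  where there is no segment.\<close>

lemma piecewise_geodesic:
  assumes "geodesic_space M d" "\<forall>i\<le>n. x i \<in> M" "T = (\<Sum>i<n. d (x i) (x (Suc i)))"
  shows "\<exists>p. p ` {0..T} \<subseteq> M \<and> p 0 = x 0 \<and> p T = x n \<and>
    (\<forall>s\<in>{0..T}. \<forall>s'\<in>{0..T}. d (p s) (p s') \<le> \<bar>s - s'\<bar>) \<and>
    (\<forall>s\<in>{0..T}. p s = x 0 \<or>
       (\<exists>k<n. d (x k) (p s) + d (p s) (x (Suc k)) = d (x k) (x (Suc k))))"
  using assms(2,3)
proof (induction n arbitrary: T)
  case 0
  interpret Metric_space M d using assms(1) by (simp add: geodesic_space_def)
  show ?case using 0 by (intro exI[of _ "\<lambda>_. x 0"]) auto
next
  case (Suc n)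
  interpret Metric_space M d using assms(1) by (simp add: geodesic_space_def)
  define S where "S = (\<Sum>i<n. d (x i) (x (Suc i)))"
  define l where "l = d (x n) (x (Suc n))"
  have T: "T = S + l" and S0: "S \<ge> 0" and l0: "l \<ge> 0"
    using Suc.prems(2) by (simp_all add: S_def l_def sum_nonneg)
  have "\<forall>i\<le>n. x i \<in> M" and xn: "x n \<in> M" "x (Suc n) \<in> M" using Suc.prems(1) by auto
  from Suc.IH[OF this(1) S_def] obtain p where p: "p ` {0..S} \<subseteq> M" "p 0 = x 0" "p S = x n"
    "\<forall>s\<in>{0..S}. \<forall>s'\<in>{0..S}. d (p s) (p s') \<le> \<bar>s - s'\<bar>"
    "\<forall>s\<in>{0..S}. p s = x 0 \<or> (\<exists>k<n. d (x k) (p s) + d (p s) (x (Suc k)) = d (x k) (x (Suc k)))"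
    by (elim exE conjE)
  obtain g where g: "g ` {0..l} \<subseteq> M" "g 0 = x n" "g l = x (Suc n)"
    "\<And>s s'. s \<in> {0..l} \<Longrightarrow> s' \<in> {0..l} \<Longrightarrow> d (g s) (g s') = \<bar>s - s'\<bar>"
    using geodesicE[OF assms(1) xn] unfolding l_def by blast
  define q where "q = (\<lambda>s. if s \<le> S then p s else g (s - S))"
  have qM: "q s \<in> M" if "s \<in> {0..T}" for s
    using that p(1) g(1) by (auto simp: q_def T image_subset_iff)
  have le: "d (q s) (q s') \<le> \<bar>s - s'\<bar>" if "s \<in> {0..T}" "s' \<in> {0..T}" "s \<le> s'" for s s'
  proof -
    consider "s' \<le> S" | "s > S" | "s \<le> S" "s' > S" by linarith
    then show ?thesis
    proof cases
      case 1
      then show ?thesis using that p(4)[rule_format, of s s'] by (simp add: q_def)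
    next
      case 2
      then show ?thesis using that g(4)[of "s - S" "s' - S"] by (simp add: q_def T)
    next
      case 3
      then have "p s \<in> M" "x n \<in> M" "g (s' - S) \<in> M"
        using that qM[of s] qM[of s'] Suc.prems(1) by (auto simp: q_def)
      then have "d (p s) (g (s' - S)) \<le> d (p s) (p S) + d (g 0) (g (s' - S))"
        unfolding p(3) g(2) by (rule triangle)
      also have "\<dots> \<le> \<bar>s - S\<bar> + \<bar>0 - (s' - S)\<bar>"
        using that 3 p(4)[rule_format, of s S] g(4)[of 0 "s' - S"] S0 l0 T by simp
      finally show ?thesis using 3 by (simp add: q_def)
    qed
  qed
  have "d (q s) (q s') \<le> \<bar>s - s'\<bar>" if "s \<in> {0..T}" "s' \<in> {0..T}" for s s'
    using le[OF that] le[OF that(2,1)] commute[of "q s" "q s'"] by linarith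
  moreover have "q 0 = x 0" "q T = x (Suc n)"
    using S0 l0 p(2,3) g(2,3) by (auto simp: q_def T)
  moreover have "q s = x 0 \<or>
      (\<exists>k<Suc n. d (x k) (q s) + d (q s) (x (Suc k)) = d (x k) (x (Suc k)))" if "s \<in> {0..T}" for s
  proof (cases "s \<le> S")
    case True
    then have "p s = x 0 \<or> (\<exists>k<n. d (x k) (p s) + d (p s) (x (Suc k)) = d (x k) (x (Suc k)))"
      using p(5) that by simp
    then show ?thesis unfolding q_def using True less_SucI by (simp, blast)
  next
    case False
    then have "d (g 0) (g (s - S)) + d (g (s - S)) (g l) = l"
      using that T g(4)[of 0 "s - S"] g(4)[of "s - S" l] by simp
    then have "d (x n) (q s) + d (q s) (x (Suc n)) = d (x n) (x (Suc n))"
      using False g(2,3) by (simp add: q_def l_def)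
    then show ?thesis by blast
  qed
  moreover have "q ` {0..T} \<subseteq> M" using qM by blast
  ultimately show ?case by blast
qed

text \<open>Continuity yields some partition with steps of size at most 1. In one with the fewest
  steps, any two consecutive steps have total size greater than 1, so the number of steps is at most
  about twice the length.\<close>

lemma path_unit_walk:
  assumes "Metric_space M d" "continuous_path M d {u..v} p" "u \<le> v"
    and len: "arclength d u v p \<le> ennreal B" "B \<ge> 0"
  obtains n w where "w 0 = p u" "w n = p v" "\<forall>i\<le>n. w i \<in> p ` {u..v}"
    "\<forall>i<n. d (w i) (w (Suc i)) \<le> 1" "real n \<le> 2 * B + 1"
proof -
  interpret Metric_space M d by fact
  define R where "R = (\<lambda>s s'. u \<le> s \<and> s \<le> s' \<and> s' \<le> v \<and> d (p s) (p s') \<le> 1)"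
  have pM: "p s \<in> M" if "u \<le> s" "s \<le> v" for s
    using assms(2) that unfolding continuous_path_iff[OF assms(1)] by auto
  \<comment> \<open>Bolzano's lemma tests intervals that may stick out of \<open>{u..v}\<close>,
    where nothing is known about \<open>p\<close>; the premises on \<open>a\<close> and
    \<open>b\<close> make \<open>P\<close> hold trivially there.\<close>
  define P where "P = (\<lambda>a b. u \<le> a \<and> b \<le> v \<longrightarrow> R\<^sup>*\<^sup>* a b)"
  have "P u v"
    using \<open>u \<le> v\<close>
  proof (rule Bolzano)
    fix a b c assume "P a b" "P b c" "a \<le> b" "b \<le> c"
    then show "P a c" unfolding P_def by (meson order_trans rtranclp_trans)
  next
    fix x assume "u \<le> x" "x \<le> v"
    then have "x \<in> {u..v}" by simp
    then obtain \<delta> where \<delta>: "\<delta> > 0" "\<And>s. s \<in> {u..v} \<Longrightarrow> \<bar>s - x\<bar> < \<delta> \<Longrightarrow> d (p x) (p s) < 1/2"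
      using assms(2)[unfolded continuous_path_iff[OF assms(1)]]
      by (metis half_gt_zero_iff zero_less_one)
    have "R\<^sup>*\<^sup>* a b" if "a \<le> x" "x \<le> b" "b - a < \<delta>" "u \<le> a" "b \<le> v" for a b
    proof -
      have "d (p a) (p b) \<le> d (p x) (p a) + d (p x) (p b)"
        using that pM by (intro triangle'') auto
      also have "\<dots> \<le> 1" using \<delta>(2)[of a] \<delta>(2)[of b] that by auto
      finally show ?thesis using that by (auto simp: R_def)
    qed
    then show "\<exists>\<delta>>0. \<forall>a b. a \<le> x \<and> x \<le> b \<and> b - a < \<delta> \<longrightarrow> P a b"
      unfolding P_def using \<delta>(1) by blast
  qed
  then have "\<exists>n. (R ^^ n) u v" unfolding P_def by (intro rtranclp_imp_relpowp) simp
  then obtain n where n: "(R ^^ n) u v" and n_min: "\<And>k. k < n \<Longrightarrow> \<not> (R ^^ k) u v"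
    using exists_least_iff[of "\<lambda>n. (R ^^ n) u v"] by auto
  then obtain x where x: "x 0 = u" "x n = v" "\<And>i. i < n \<Longrightarrow> R (x i) (x (Suc i))"
    unfolding relpowp_fun_conv by blast
  have mono: "\<forall>i<n. x i \<le> x (Suc i)" using x(3) by (simp add: R_def)
  have xuv: "u \<le> x i" "x i \<le> v" if "i \<le> n" for i
    using partition_mono[OF mono, of 0 i] partition_mono[OF mono, of i n] that x by auto
  define e where "e i = d (p (x i)) (p (x (Suc i)))" for i
  \<comment> \<open>A partition point between two steps of total length at most 1 could be dropped.\<close>
  have pair: "e i + e (Suc i) > 1" if "Suc i < n" for i
  proof (rule ccontr)
    assume "\<not> e i + e (Suc i) > 1"
    moreover have "d (p (x i)) (p (x (Suc (Suc i)))) \<le> e i + e (Suc i)"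
      unfolding e_def using that xuv by (intro triangle pM) auto
    ultimately have "R (x i) (x (Suc (Suc i)))"
      using that mono[rule_format, of i] mono[rule_format, of "Suc i"] xuv(1)[of i]
        xuv(2)[of "Suc (Suc i)"] by (simp add: R_def)
    then have "(R ^^ (n - 1)) u v"
      unfolding relpowp_fun_conv using that x
      by (intro exI[of _ "\<lambda>k. if k \<le> i then x k else x (Suc k)"]) (auto simp: le_less)
    then show False using n_min[of "n - 1"] that by simp
  qed
  \<comment> \<open>The steps are grouped into disjoint pairs. An unpaired last step is the reason
    for the \<open>+ 1\<close> in the bound on \<open>n\<close>.\<close>
  have "2 * k \<le> n \<Longrightarrow> real k \<le> (\<Sum>i<2*k. e i)" for k
  proof (induction k)
    case (Suc k)
    then show ?case using pair[of "2*k"] by (simp add: algebra_simps)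
  qed simp
  from this[of "n div 2"] have "real (n div 2) \<le> (\<Sum>i<2 * (n div 2). e i)" by simp
  also have "\<dots> \<le> (\<Sum>i<n. e i)" by (intro sum_mono2) (auto simp: e_def)
  also have "\<dots> \<le> B"
  proof -
    have "ennreal (\<Sum>i<n. e i) = (\<Sum>i<n. ennreal (d (p (x i)) (p (x (Suc i)))))"
      by (subst sum_ennreal) (auto simp: e_def)
    also have "\<dots> \<le> arclength d u v p"
      unfolding arclength_def using x mono by (intro Sup_upper) blast
    also have "\<dots> \<le> ennreal B" by fact
    finally show ?thesis using \<open>B \<ge> 0\<close> by simp
  qed
  finally have "real (n div 2) \<le> B" .
  moreover have "real n \<le> 2 * real (n div 2) + 1" by linarith
  ultimately have "real n \<le> 2 * B + 1" by linarith
  moreover have "\<forall>i\<le>n. p (x i) \<in> p ` {u..v}" "\<forall>i<n. d (p (x i)) (p (x (Suc i))) \<le> 1"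
    using xuv x(3) by (simp_all add: R_def)
  ultimately show thesis
    using that[of "\<lambda>i. p (x i)" n] x(1,2) by simp
qed

subsection \<open>Walks with unit steps\<close>

lemma walk_dist:
  assumes "Metric_space M d" "\<forall>i\<le>n. z i \<in> M" "\<forall>i<n. d (z i) (z (Suc i)) \<le> c"
    and "i \<le> j" "j \<le> n"
  shows "d (z i) (z j) \<le> c * real (j - i)"
  using assms(4,5)
proof (induction j rule: dec_induct)
  case base
  then show ?case using Metric_space.mdist_zero[OF assms(1)] assms(2) by simp
next
  case (step j)
  then have "d (z i) (z (Suc j)) \<le> d (z i) (z j) + d (z j) (z (Suc j))"
    using assms(2) by (intro Metric_space.triangle[OF assms(1)]) auto
  also have "\<dots> \<le> c * real (j - i) + c" using step assms(3) by (intro add_mono) auto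
  finally show ?case using step by (simp add: Suc_diff_le algebra_simps)
qed

text \<open>Rounding both parameters down changes their difference by at most 1. The additive
  constant 2 absorbs this error together with the \<open>+ 1\<close> in \<open>low\<close>, because
  \<open>1 \<le> K\<close>.\<close>

lemma quasigeodesic_of_walk:
  assumes M: "Metric_space M d" and K: "1 \<le> K"
    and z: "\<forall>i\<le>n. z i \<in> M" "\<forall>i<n. d (z i) (z (Suc i)) \<le> 1"
    and low: "\<And>i j. i \<le> j \<Longrightarrow> j \<le> n \<Longrightarrow> real (j - i) \<le> K * (d (z i) (z j) + 1)"
  shows "quasigeodesic M d K 2 {0..real n} (\<lambda>s. z (nat \<lfloor>s\<rfloor>))"
proof -
  interpret Metric_space M d by fact
  have bound: "nat \<lfloor>s\<rfloor> \<le> n" if "s \<in> {0..real n}" for s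
    using that by (simp add: le_nat_floor floor_le_iff nat_le_iff)
  have main: "\<bar>s - s'\<bar> / K - 2 \<le> d (z (nat \<lfloor>s\<rfloor>)) (z (nat \<lfloor>s'\<rfloor>)) \<and>
      d (z (nat \<lfloor>s\<rfloor>)) (z (nat \<lfloor>s'\<rfloor>)) \<le> K * \<bar>s - s'\<bar> + 2"
    if s: "s \<in> {0..real n}" "s' \<in> {0..real n}" "s \<le> s'" for s s'
  proof -
    define i j where "i = nat \<lfloor>s\<rfloor>" and "j = nat \<lfloor>s'\<rfloor>"
    have ij: "i \<le> j" "j \<le> n" using s bound[of s'] by (auto simp: i_def j_def floor_mono nat_mono)
    have fl: "real i = of_int \<lfloor>s\<rfloor>" "real j = of_int \<lfloor>s'\<rfloor>" using s by (auto simp: i_def j_def)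
    have diff: "real (j - i) \<le> s' - s + 1" "s' - s \<le> real (j - i) + 1"
      using ij fl by (auto simp: of_nat_diff) linarith+
    have "s' - s \<le> K * (d (z i) (z j) + 1) + 1" using low[OF ij] diff by linarith
    also have "\<dots> \<le> K * (d (z i) (z j) + 2)" using K by (simp add: algebra_simps)
    finally have "(s' - s) / K \<le> d (z i) (z j) + 2" using K by (simp add: divide_le_eq mult.commute)
    moreover have "d (z i) (z j) \<le> s' - s + 1" using walk_dist[OF M z ij] diff by simp
    moreover have "1 * (s' - s) \<le> K * (s' - s)" using K s by (intro mult_right_mono) auto
    ultimately show ?thesis using s unfolding i_def j_def by simp
  qed
  have "\<bar>s - s'\<bar> / K - 2 \<le> d (z (nat \<lfloor>s\<rfloor>)) (z (nat \<lfloor>s'\<rfloor>)) \<and>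
      d (z (nat \<lfloor>s\<rfloor>)) (z (nat \<lfloor>s'\<rfloor>)) \<le> K * \<bar>s - s'\<bar> + 2"
    if s: "s \<in> {0..real n}" "s' \<in> {0..real n}" for s s'
    using main[OF s] main[OF s(2,1)] commute[of "z (nat \<lfloor>s\<rfloor>)" "z (nat \<lfloor>s'\<rfloor>)"]
    by (metis abs_minus_commute linear)
  then show ?thesis
    unfolding quasigeodesic_def using K z(1) bound by (auto simp: is_interval_cc)
qed

text \<open>The starting point is not charged, so costs add up when walks are concatenated. Since
  costs are natural numbers, a least one exists without any compactness of the space.\<close>

inductive walk_cost :: "'a set \<Rightarrow> ('a \<Rightarrow> 'a \<Rightarrow> real) \<Rightarrow> ('a \<Rightarrow> nat) \<Rightarrow> 'a \<Rightarrow> 'a \<Rightarrow> nat \<Rightarrow> bool"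
  for M d \<phi> a where
  start: "walk_cost M d \<phi> a a 0"
| step: "walk_cost M d \<phi> a x c \<Longrightarrow> x \<in> M \<Longrightarrow> y \<in> M \<Longrightarrow> d x y \<le> 1 \<Longrightarrow> walk_cost M d \<phi> a y (c + \<phi> y)"

text \<open>A cheapest walk is a quasigeodesic because the weights lie between \<open>1\<close> and \<open>K\<close>.\<close>

lemma optimal_walk:
  assumes geo: "geodesic_space M d" and ab: "a \<in> M" "b \<in> M"
    and \<phi>: "\<And>x. 1 \<le> \<phi> x" "\<And>x. \<phi> x \<le> K"
  obtains n z where "z 0 = a" "z n = b" "\<forall>i\<le>n. z i \<in> M" "\<forall>i<n. d (z i) (z (Suc i)) \<le> 1"
    "\<And>i j. i \<le> j \<Longrightarrow> j \<le> n \<Longrightarrow> real (\<Sum>l=i..<j. \<phi> (z (Suc l))) \<le> real K * (d (z i) (z j) + 1)"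
    "\<And>c. walk_cost M d \<phi> a b c \<Longrightarrow> (\<Sum>l=0..<n. \<phi> (z (Suc l))) \<le> c"
proof -
  interpret Metric_space M d using geo by (simp add: geodesic_space_def)
  define W where "W = walk_cost M d \<phi> a"
  \<comment> \<open>A walk ending at \<open>x\<close> is prolonged to \<open>y\<close> along
    geodesics in at most \<open>k\<close> unit steps, each costing at most \<open>K\<close>.\<close>
  have far: "\<exists>c'\<le>c + K * k. W y c'" if Wx: "W x c" and x: "x \<in> M" and y: "y \<in> M" "d x y \<le> real k" for x y c k
    using y
  proof (induction k arbitrary: y)
    case 0
    then have "d x y = 0" using nonneg[of x y] by linarith
    then have "x = y" using 0 x by simp
    then show ?case using Wx by auto
  next
    case (Suc k)
    show ?case
    proof (cases "d x y \<le> real k")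
      case True
      then obtain c' where "c' \<le> c + K * k" "W y c'" using Suc.IH[of y] Suc.prems(1) by blast
      then show ?thesis by (intro exI[of _ c']) simp
    next
      case False
      obtain g where g: "g ` {0..d x y} \<subseteq> M" "g 0 = x" "g (d x y) = y"
        "\<And>s s'. s \<in> {0..d x y} \<Longrightarrow> s' \<in> {0..d x y} \<Longrightarrow> d (g s) (g s') = \<bar>s - s'\<bar>"
        using geodesicE[OF geo x Suc.prems(1)] by blast
      have w: "g (real k) \<in> M" "d x (g (real k)) \<le> real k" "d (g (real k)) y \<le> 1"
        using g(1) g(4)[of 0 "real k"] g(4)[of "real k" "d x y"] False Suc.prems(2)
        unfolding g(2,3) by auto
      obtain c' where "c' \<le> c + K * k" "W (g (real k)) c'" using Suc.IH[OF w(1,2)] by blast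
      moreover from this(2) have "W y (c' + \<phi> y)"
        unfolding W_def by (rule walk_cost.step) (use w Suc.prems in auto)
      moreover have "c' + \<phi> y \<le> c + K * Suc k" using calculation(1) \<phi>(2)[of y] by simp
      ultimately show ?thesis by blast
    qed
  qed
  define f where "f y = (LEAST c. W y c)" for y
  have f_le: "f y \<le> c" if "W y c" for y c unfolding f_def using that by (rule Least_le)
  have f_W: "W y (f y)" if "y \<in> M" for y
  proof -
    have "W a 0" unfolding W_def by (rule walk_cost.start)
    from far[OF this ab(1) that, of "nat \<lceil>d a y\<rceil>"] have "\<exists>c. W y c" by (auto simp: real_nat_ceiling_ge)
    then show ?thesis unfolding f_def by (rule LeastI_ex)
  qed
  have f_a: "f a = 0" using f_le[of a 0] walk_cost.start[of M d \<phi> a] by (simp add: W_def)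
  have lip: "real (f y) \<le> real (f x) + real K * (d x y + 1)" if "x \<in> M" "y \<in> M" for x y
  proof -
    define k where "k = nat \<lceil>d x y\<rceil>"
    have k: "d x y \<le> real k" "real k \<le> d x y + 1"
      using nonneg[of x y] unfolding k_def by linarith+
    from far[OF f_W[OF that(1)] that k(1)] obtain c' where "c' \<le> f x + K * k" "W y c'" by blast
    then have "f y \<le> f x + K * k" using f_le by fastforce
    then have "real (f y) \<le> real (f x) + real K * real k" by (metis of_nat_add of_nat_le_iff of_nat_mult)
    also have "\<dots> \<le> real (f x) + real K * (d x y + 1)" using k(2) by (intro add_left_mono mult_left_mono) auto
    finally show ?thesis .
  qed
  \<comment> \<open>The last step of a cheapest walk is tight: the walk before it must be cheapest
    for its own end, for otherwise \<open>y\<close> could be reached at a lower cost.\<close>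
  have pred: "y = a \<or> (\<exists>x\<in>M. d x y \<le> 1 \<and> f y = f x + \<phi> y)" if "y \<in> M" for y
    using f_W[OF that] unfolding W_def
  proof (cases rule: walk_cost.cases)
    case (step x c)
    have "f x \<le> c" using step f_le by (simp add: W_def)
    moreover have "f y \<le> f x + \<phi> y"
      by (rule f_le) (use step f_W[of x] walk_cost.step in \<open>simp add: W_def\<close>)
    ultimately show ?thesis using step by auto
  qed simp
  \<comment> \<open>Tight steps are traced back from \<open>y\<close>. Every weight is at least 1,
    so \<open>f\<close> drops at each step and the trace ends at \<open>a\<close>.\<close>
  have "\<exists>n z. z 0 = a \<and> z n = y \<and> (\<forall>i\<le>n. z i \<in> M) \<and>
      (\<forall>i<n. d (z i) (z (Suc i)) \<le> 1 \<and> f (z (Suc i)) = f (z i) + \<phi> (z (Suc i)))" if "y \<in> M" for y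
    using that
  proof (induction "f y" arbitrary: y rule: less_induct)
    case less
    show ?case
    proof (cases "y = a")
      case True
      then show ?thesis using ab by (intro exI[of _ 0] exI[of _ "\<lambda>_. a"]) auto
    next
      case False
      then obtain x where x: "x \<in> M" "d x y \<le> 1" "f y = f x + \<phi> y" using pred less.prems by blast
      then have "f x < f y" using \<phi>(1)[of y] by simp
      from less.hyps[OF this x(1)] obtain n z where nz: "z 0 = a" "z n = x" "\<forall>i\<le>n. z i \<in> M"
        "\<forall>i<n. d (z i) (z (Suc i)) \<le> 1 \<and> f (z (Suc i)) = f (z i) + \<phi> (z (Suc i))" by blast
      then show ?thesis using x less.prems
        by (intro exI[of _ "Suc n"] exI[of _ "z(Suc n := y)"]) (auto simp: less_Suc_eq le_Suc_eq)
    qed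
  qed
  from this[OF ab(2)] obtain n z where z: "z 0 = a" "z n = b" "\<forall>i\<le>n. z i \<in> M"
    "\<forall>i<n. d (z i) (z (Suc i)) \<le> 1" "\<forall>i<n. f (z (Suc i)) = f (z i) + \<phi> (z (Suc i))" by blast
  \<comment> \<open>The cost of each stretch is a difference of values of \<open>f\<close>, so
    \<open>lip\<close> bounds the cost of every subwalk, as a quasigeodesic requires, and not only
    that of the whole walk.\<close>
  have sum: "f (z i) + (\<Sum>l=i..<j. \<phi> (z (Suc l))) = f (z j)" if "i \<le> j" "j \<le> n" for i j
    using that by (induction j rule: dec_induct) (use z(5) in auto)
  show thesis
  proof (rule that[OF z(1-4)])
    fix i j assume ij: "i \<le> j" "j \<le> n"
    have "real (f (z i)) + real (\<Sum>l=i..<j. \<phi> (z (Suc l))) = real (f (z j))"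
      using sum[OF ij] by (metis of_nat_add)
    then show "real (\<Sum>l=i..<j. \<phi> (z (Suc l))) \<le> real K * (d (z i) (z j) + 1)"
      using lip[of "z i" "z j"] z(3) ij by fastforce
  next
    fix c assume "walk_cost M d \<phi> a b c"
    then show "(\<Sum>l=0..<n. \<phi> (z (Suc l))) \<le> c"
      using sum[of 0 n] f_le[of b c] f_a z(1,2) by (simp add: W_def)
  qed
qed

lemma walk_cost_of_cheap_walk:
  assumes "\<forall>i\<le>n. w i \<in> M" "\<forall>i<n. d (w i) (w (Suc i)) \<le> 1" "\<forall>i\<le>n. \<phi> (w i) = 1"
  shows "walk_cost M d \<phi> (w 0) (w n) n"
  using assms
proof (induction n)
  case 0
  show ?case by (rule walk_cost.start)
next
  case (Suc n)
  then have "walk_cost M d \<phi> (w 0) (w (Suc n)) (n + \<phi> (w (Suc n)))"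
    by (intro walk_cost.step[of M d \<phi> "w 0" "w n"]) auto
  then show ?case using Suc.prems by simp
qed

lemma last_before:
  fixes P :: "nat \<Rightarrow> bool"
  assumes "P i" "i \<le> n" "\<not> P n"
  obtains k where "i \<le> k" "k < n" "P k" "\<And>j. k < j \<Longrightarrow> j \<le> n \<Longrightarrow> \<not> P j"
proof -
  define k where "k = (GREATEST k. P k \<and> k \<le> n)"
  have "P k \<and> k \<le> n" unfolding k_def by (rule GreatestI_nat[of _ i n]) (use assms in auto)
  moreover have "j \<le> k" if "P j" "j \<le> n" for j
    unfolding k_def by (rule Greatest_le_nat[of _ _ n]) (use that in auto)
  ultimately show thesis using that[of k] assms by (metis le_neq_implies_less not_le)
qed

lemma first_after:
  fixes P :: "nat \<Rightarrow> bool"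
  assumes "P n" "i < n"
  obtains k where "i < k" "k \<le> n" "P k" "\<And>j. i < j \<Longrightarrow> j < k \<Longrightarrow> \<not> P j"
proof -
  define k where "k = (LEAST k. i < k \<and> P k)"
  have "i < k \<and> P k" unfolding k_def by (rule LeastI[of _ n]) (use assms in auto)
  moreover have "k \<le> j" if "i < j" "P j" for j
    unfolding k_def by (rule Least_le) (use that in auto)
  ultimately show thesis using that[of k] assms by (metis not_le)
qed

subsection \<open>Stable quasigeodesics are middle recurrent\<close>

lemma quasigeodesicD:
  assumes "quasigeodesic M d \<kappa> L I q"
  shows "\<kappa> \<ge> 1" "L > 0" "is_interval I" "\<And>s. s \<in> I \<Longrightarrow> q s \<in> M"
    "\<And>s s'. s \<in> I \<Longrightarrow> s' \<in> I \<Longrightarrow> d (q s) (q s') \<le> \<kappa> * \<bar>s - s'\<bar> + L"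
    "\<And>s s'. s \<in> I \<Longrightarrow> s' \<in> I \<Longrightarrow> \<bar>s - s'\<bar> \<le> \<kappa> * (d (q s) (q s') + L)"
proof -
  note q = assms[unfolded quasigeodesic_def]
  show "\<kappa> \<ge> 1" "L > 0" "is_interval I" "\<And>s. s \<in> I \<Longrightarrow> q s \<in> M" using q by auto
  show "d (q s) (q s') \<le> \<kappa> * \<bar>s - s'\<bar> + L" if "s \<in> I" "s' \<in> I" for s s' using q that by blast
  show "\<bar>s - s'\<bar> \<le> \<kappa> * (d (q s) (q s') + L)" if "s \<in> I" "s' \<in> I" for s s'
  proof -
    have "\<bar>s - s'\<bar> / \<kappa> - L \<le> d (q s) (q s')" using q that by blast
    then have "\<bar>s - s'\<bar> / \<kappa> \<le> d (q s) (q s') + L" by simp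
    then show ?thesis using q by (simp add: divide_le_eq mult.commute)
  qed
qed

text \<open>The intermediate value theorem gives a point of \<open>q\<close> equidistant from
  \<open>q r\<close> and \<open>q r'\<close>; by the triangle inequality its distance to each of
  them is at least half of \<open>d (q r) (q r')\<close>.\<close>

lemma t_middle_nonempty:
  assumes "Metric_space M d" "continuous_path M d I q" "r \<in> I" "r' \<in> I" "r \<le> r'" "t \<le> 1/2"
  obtains s where "s \<in> I" "r \<le> s" "s \<le> r'" "q s \<in> t_middle d I q t (q r) (q r')"
proof -
  interpret Metric_space M d by fact
  note q = assms(2)[unfolded continuous_path_iff[OF assms(1)]]
  have I: "s \<in> I" if "r \<le> s" "s \<le> r'" for s
    using q that assms(3,4) mem_is_interval_1_I by blast
  have qM: "q s \<in> M" if "s \<in> I" for s using q that by blast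
  have cont: "continuous_on {r..r'} (\<lambda>s. d (q s) x)" if "x \<in> M" for x
    unfolding continuous_on_iff
  proof (intro ballI allI impI)
    fix s and e :: real assume s: "s \<in> {r..r'}" "0 < e"
    then have "\<exists>\<delta>>0. \<forall>s'\<in>I. \<bar>s' - s\<bar> < \<delta> \<longrightarrow> d (q s) (q s') < e" using q I by simp
    then obtain \<delta> where \<delta>: "\<delta> > 0" "\<forall>s'\<in>I. \<bar>s' - s\<bar> < \<delta> \<longrightarrow> d (q s) (q s') < e" by blast
    have "dist (d (q s') x) (d (q s) x) < e" if "s' \<in> {r..r'}" "dist s' s < \<delta>" for s'
    proof -
      have "\<bar>d (q s') x - d x (q s)\<bar> \<le> d (q s') (q s)"
        using that s I qM \<open>x \<in> M\<close> by (intro mdist_reverse_triangle) auto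
      also have "\<dots> < e" using \<delta>(2) that I by (auto simp: dist_real_def commute)
      finally show ?thesis by (simp add: dist_real_def commute)
    qed
    then show "\<exists>\<delta>>0. \<forall>s'\<in>{r..r'}. dist s' s < \<delta> \<longrightarrow> dist (d (q s') x) (d (q s) x) < e"
      using \<delta>(1) by blast
  qed
  have "\<exists>s. r \<le> s \<and> s \<le> r' \<and> d (q s) (q r) - d (q s) (q r') = 0"
    using assms(3-5) by (intro IVT') (auto intro!: continuous_on_diff cont qM simp: mdist_zero[OF qM])
  then obtain s where s: "r \<le> s" "s \<le> r'" "d (q s) (q r) = d (q s) (q r')" by auto
  have "d (q r) (q r') \<le> d (q s) (q r) + d (q s) (q r')"
    using assms(3,4) I[OF s(1,2)] qM by (intro triangle'') auto
  moreover have "t * d (q r) (q r') \<le> 1/2 * d (q r) (q r')"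
    using assms(6) by (intro mult_right_mono) auto
  ultimately have "q s \<in> t_middle d I q t (q r) (q r')"
    unfolding t_middle_def lies_between_def using s I[OF s(1,2)] assms(3,4) by auto
  with s I show thesis by (intro that) auto
qed

text \<open>A discrete crossing argument for parameters that jump by at most \<open>J\<close>:
  \<open>k\<close> is the last index still on the side of \<open>r\<close>, and \<open>l\<close> is
  the first later one on the side of \<open>r'\<close>. The term \<open>\<kappa> * J + L\<close>
  bounds how far \<open>q\<close> moves when a jump passes over \<open>r\<close> or
  \<open>r'\<close>.\<close>

lemma crosses_t_middle:
  assumes "Metric_space M d" "quasigeodesic M d \<kappa> L I q"
    and r: "r \<in> I" "r' \<in> I" "r \<le> r'" and pos: "d (q r) (q r') > 0" and t: "0 \<le> t" "t < 1"
    and \<sigma>: "\<forall>i\<le>n. \<sigma> i \<in> I" "\<sigma> 0 = r" "\<sigma> n = r'" "\<forall>i<n. \<bar>\<sigma> i - \<sigma> (Suc i)\<bar> \<le> J" and J: "J \<ge> 0"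
  obtains k l where "k < l" "l \<le> n"
    "d (q (\<sigma> k)) (q r) \<le> t * d (q r) (q r') + (\<kappa> * J + L)"
    "d (q (\<sigma> l)) (q r') \<le> t * d (q r) (q r') + (\<kappa> * J + L)"
    "\<And>j. k < j \<Longrightarrow> j < l \<Longrightarrow> q (\<sigma> j) \<in> t_middle d I q t (q r) (q r')"
proof -
  interpret Metric_space M d by fact
  note q = quasigeodesicD[OF assms(2)]
  define l0 where "l0 = d (q r) (q r')"
  have E: "\<kappa> * J + L \<ge> 0" using q(1,2) J by simp
  have near: "d (q s) (q s') \<le> \<kappa> * J + L" if "s \<in> I" "s' \<in> I" "\<bar>s - s'\<bar> \<le> J" for s s'
  proof -
    have "d (q s) (q s') \<le> \<kappa> * \<bar>s - s'\<bar> + L" using q(5) that by blast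
    also have "\<dots> \<le> \<kappa> * J + L" using q(1) that by (intro add_mono mult_left_mono) auto
    finally show ?thesis .
  qed
  have lt: "t * l0 < l0" "l0 > 0" "t * l0 \<ge> 0" using pos t by (simp_all add: l0_def)
  have "r < r'" using r pos q(4)[OF r(1)] by (cases "r = r'") auto
  \<comment> \<open>Parameters may wander outside \<open>{r..r'}\<close>; counting those as ends
    keeps the parameters strictly between \<open>k\<close> and \<open>l\<close> inside the interval.
    The condition \<open>\<sigma> i \<le> r'\<close> in \<open>A\<close> ensures that a jump ending
    at or beyond \<open>r'\<close> starts at or before \<open>r'\<close>, even if
    \<open>l - 1 = k\<close>.\<close>
  define A where "A i \<longleftrightarrow> \<sigma> i \<le> r \<or> \<sigma> i \<le> r' \<and> d (q (\<sigma> i)) (q r) < t * l0" for i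
  define B where "B i \<longleftrightarrow> \<sigma> i \<ge> r' \<or> d (q (\<sigma> i)) (q r') < t * l0" for i
  have "A 0" using \<sigma>(2) by (simp add: A_def)
  moreover have "\<not> A n" using \<open>r < r'\<close> \<sigma>(3) lt by (simp add: A_def l0_def commute)
  ultimately obtain k where k: "k < n" "A k" and kA: "\<And>j. k < j \<Longrightarrow> j \<le> n \<Longrightarrow> \<not> A j"
    using last_before[of A 0 n] by auto
  have "B n" using \<sigma>(3) by (simp add: B_def)
  then obtain l where l: "k < l" "l \<le> n" "B l" and lB: "\<And>j. k < j \<Longrightarrow> j < l \<Longrightarrow> \<not> B j"
    using first_after[of B n k] k(1) by blast
  have "d (q (\<sigma> k)) (q r) \<le> t * l0 + (\<kappa> * J + L)"
  proof (cases "\<sigma> k \<le> r' \<and> d (q (\<sigma> k)) (q r) < t * l0")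
    case False
    then have "\<sigma> k \<le> r" using k(2) by (auto simp: A_def)
    moreover have "\<sigma> (Suc k) > r" using kA[of "Suc k"] k(1) by (simp add: A_def)
    moreover have "\<bar>\<sigma> k - \<sigma> (Suc k)\<bar> \<le> J" using \<sigma>(4) k(1) by blast
    ultimately have "d (q (\<sigma> k)) (q r) \<le> \<kappa> * J + L" using \<sigma>(1) k(1) r(1) by (intro near) auto
    then show ?thesis using lt by simp
  qed (use E in simp)
  moreover have "d (q (\<sigma> l)) (q r') \<le> t * l0 + (\<kappa> * J + L)"
  proof (cases "d (q (\<sigma> l)) (q r') < t * l0")
    case False
    then have "\<sigma> l \<ge> r'" using l(3) by (auto simp: B_def)
    moreover have "\<sigma> (l - 1) \<le> r'"
    proof (cases "l - 1 = k")
      case True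
      then show ?thesis using k(2) r(3) by (auto simp: A_def)
    next
      case False
      then have "k < l - 1" using l(1) by linarith
      then show ?thesis using lB[of "l - 1"] by (simp add: B_def)
    qed
    moreover have "\<bar>\<sigma> (l - 1) - \<sigma> (Suc (l - 1))\<bar> \<le> J"
      using \<sigma>(4) l(1,2) by (metis Suc_pred' Suc_le_lessD less_nat_zero_code not_gr_zero)
    ultimately have "d (q (\<sigma> l)) (q r') \<le> \<kappa> * J + L" using \<sigma>(1) l r(2) by (intro near) auto
    then show ?thesis using lt by simp
  qed (use E in simp)
  moreover have "q (\<sigma> j) \<in> t_middle d I q t (q r) (q r')" if j: "k < j" "j < l" for j
  proof -
    have "\<sigma> j \<in> I" "\<sigma> j > r" "\<sigma> j < r'" "d (q (\<sigma> j)) (q r) \<ge> t * l0" "d (q (\<sigma> j)) (q r') \<ge> t * l0"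
      using kA[of j] lB[of j] j l(2) \<sigma>(1) by (auto simp: A_def B_def)
    then show ?thesis
      using r unfolding t_middle_def lies_between_def l0_def by (auto intro: less_imp_le)
  qed
  ultimately show thesis using that[OF l(1,2)] by (simp add: l0_def)
qed

lemma stable_withD:
  assumes "stable_with M d D I q" "u \<le> v" "quasigeodesic M d \<kappa> L {u..v} \<eta>" "\<eta> u \<in> q ` I" "\<eta> v \<in> q ` I"
  shows "\<eta> ` {u..v} \<subseteq> nbhd M d (D \<kappa> L) (q ` I)"
  using assms(1)[unfolded stable_with_def, THEN conjunct2, rule_format, OF assms(2-5)] .

text \<open>The cheapest walk stays within \<open>D (real K) 2\<close> of \<open>q\<close>. Points
  of \<open>q\<close> chosen near consecutive points of the walk are at distance at most
  \<open>2 * D (real K) 2 + 1\<close>, which bounds the jump of their parameters, and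
  \<open>E\<close> bounds how far \<open>q\<close> moves in such a jump. If \<open>p\<close> avoids
  the neighbourhood, comparing costs yields \<open>d (q r) (q r') \<le> B\<close>. The first lower
  bound on \<open>m\<close> makes the walk heavy near the middle, the second settles the case of
  close endpoints.\<close>

lemma stable_path_meets_middle:
  assumes geo: "geodesic_space M d" and q: "quasigeodesic M d \<kappa> L I q"
    and cont: "continuous_path M d I q" and D: "stable_with M d D I q"
    and t: "0 < t" "t < 1/2" and C: "C > 0" and K: "3 * C \<le> real K * (1 - 2 * t)" "K \<ge> 1"
    and E: "E = \<kappa> * (\<kappa> * (2 * D (real K) 2 + 1 + L)) + L"
    and B: "B = (real K * (2 * E + 2 * D (real K) 2 + 1) + 1) / C"
    and m: "m \<ge> D (real K) 2" "m \<ge> \<kappa> * (\<kappa> * (B + L)) + L"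
    and r: "r \<in> I" "r' \<in> I" "r \<le> r'"
    and p: "continuous_path M d {u..v} p" "u \<le> v"
      "(p u = q r \<and> p v = q r') \<or> (p u = q r' \<and> p v = q r)"
      "arclength d u v p \<le> ennreal (C * d (q r) (q r'))"
  shows "p ` {u..v} \<inter> nbhd M d m (t_middle d I q t (q r) (q r')) \<noteq> {}"
proof -
  have M: "Metric_space M d" using geo by (simp add: geodesic_space_def)
  interpret Metric_space M d by fact
  note Q = quasigeodesicD[OF q]
  define D0 where "D0 = D (real K) 2"
  define l0 where "l0 = d (q r) (q r')"
  define mid where "mid = t_middle d I q t (q r) (q r')"
  have "D0 \<ge> 0" using D by (simp add: stable_with_def D0_def)
  have pM: "p ` {u..v} \<subseteq> M" using p(1) unfolding continuous_path_iff[OF M] by blast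
  have qr: "q r \<in> p ` {u..v}" using p(2,3) by (metis atLeastAtMost_iff imageI order_refl)
  show ?thesis
  proof (cases "l0 \<le> B")
    \<comment> \<open>The endpoints are close, hence so are their parameters, and any middle point
      is near \<open>q r\<close>, which lies on \<open>p\<close>.\<close>
    case True
    obtain s where s: "s \<in> I" "r \<le> s" "s \<le> r'" "q s \<in> mid"
      using t_middle_nonempty[OF M cont r] t unfolding mid_def by (metis less_imp_le)
    have "\<bar>r - s\<bar> \<le> \<bar>r - r'\<bar>" using s by simp
    also have "\<dots> \<le> \<kappa> * (l0 + L)" using Q(6)[OF r(1,2)] by (simp add: l0_def)
    also have "\<dots> \<le> \<kappa> * (B + L)" using True Q(1) by (intro mult_left_mono) auto
    finally have "\<kappa> * \<bar>r - s\<bar> \<le> \<kappa> * (\<kappa> * (B + L))" using Q(1) by (intro mult_left_mono) auto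
    then have "d (q r) (q s) \<le> m" using Q(5)[OF r(1) s(1)] m(2) by linarith
    then have "q r \<in> nbhd M d m mid" using s(4) Q(4)[OF r(1)] unfolding nbhd_def by blast
    then show ?thesis using qr unfolding mid_def by blast
  next
    case far: False
    show ?thesis
    proof (rule ccontr)
      assume "\<not> ?thesis"
      then have avoid: "x \<notin> nbhd M d m mid" if "x \<in> p ` {u..v}" for x using that by (auto simp: mid_def)
      define \<phi> where "\<phi> x = (if x \<in> nbhd M d m mid then K else 1)" for x
      have \<phi>: "1 \<le> \<phi> x" "\<phi> x \<le> K" for x using K(2) by (auto simp: \<phi>_def)
      obtain n z where z: "z 0 = q r" "z n = q r'" "\<forall>i\<le>n. z i \<in> M" "\<forall>i<n. d (z i) (z (Suc i)) \<le> 1"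
        and eff: "\<And>i j. i \<le> j \<Longrightarrow> j \<le> n \<Longrightarrow>
          real (\<Sum>l=i..<j. \<phi> (z (Suc l))) \<le> real K * (d (z i) (z j) + 1)"
        and opt: "\<And>c. walk_cost M d \<phi> (q r) (q r') c \<Longrightarrow> (\<Sum>l=0..<n. \<phi> (z (Suc l))) \<le> c"
        using optimal_walk[OF geo Q(4)[OF r(1)] Q(4)[OF r(2)], of \<phi> K] \<phi> by metis
      have "B \<ge> 0" using C E \<open>D0 \<ge> 0\<close> Q(1,2) by (simp add: B D0_def)
      then have l0: "l0 > 0" using far by simp
      have "real (j - i) \<le> real K * (d (z i) (z j) + 1)" if ij: "i \<le> j" "j \<le> n" for i j
      proof -
        have "j - i = (\<Sum>l=i..<j. 1)" by simp
        also have "\<dots> \<le> (\<Sum>l=i..<j. \<phi> (z (Suc l)))" by (intro sum_mono \<phi>(1))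
        finally show ?thesis using eff[OF ij] by (meson of_nat_mono order_trans)
      qed
      then have "quasigeodesic M d (real K) 2 {0..real n} (\<lambda>s. z (nat \<lfloor>s\<rfloor>))"
        using K(2) by (intro quasigeodesic_of_walk[OF M _ z(3,4)]) auto
      then have sub: "(\<lambda>s. z (nat \<lfloor>s\<rfloor>)) ` {0..real n} \<subseteq> nbhd M d D0 (q ` I)"
        unfolding D0_def by (rule stable_withD[OF D, rotated]) (use r z(1,2) in auto)
      have "\<exists>s\<in>I. d (z i) (q s) \<le> D0" if "i \<le> n" for i
        using subsetD[OF sub imageI, of "real i"] that by (auto simp: nbhd_def)
      then obtain \<tau> where \<tau>: "\<And>i. i \<le> n \<Longrightarrow> \<tau> i \<in> I" "\<And>i. i \<le> n \<Longrightarrow> d (z i) (q (\<tau> i)) \<le> D0"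
        by metis
      \<comment> \<open>\<open>\<tau>\<close> may pick parameters other than \<open>r\<close> and
        \<open>r'\<close> for the two ends, but the crossing argument starts and stops exactly
        there.\<close>
      define \<sigma> where "\<sigma> i = (if i = 0 then r else if i = n then r' else \<tau> i)" for i
      have "n \<noteq> 0" using z(1,2) l0 mdist_zero[OF Q(4)[OF r(1)]] by (intro notI) (simp add: l0_def)
      then have \<sigma>0: "\<sigma> 0 = r" "\<sigma> n = r'" by (auto simp: \<sigma>_def)
      have \<sigma>I: "\<sigma> i \<in> I" if "i \<le> n" for i using that \<tau>(1) r by (simp add: \<sigma>_def)
      have \<sigma>z: "d (z i) (q (\<sigma> i)) \<le> D0" if "i \<le> n" for i
        using that \<tau>(2) z(1,2) \<open>D0 \<ge> 0\<close> Q(4)[OF r(1)] Q(4)[OF r(2)] by (auto simp: \<sigma>_def)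
      have \<sigma>M: "q (\<sigma> i) \<in> M" if "i \<le> n" for i using \<sigma>I Q(4) that by blast
      define J where "J = \<kappa> * (2 * D0 + 1 + L)"
      have "J \<ge> 0" using \<open>D0 \<ge> 0\<close> Q(1,2) by (simp add: J_def)
      have \<sigma>J: "\<bar>\<sigma> i - \<sigma> (Suc i)\<bar> \<le> J" if i: "i < n" for i
      proof -
        have "d (q (\<sigma> i)) (q (\<sigma> (Suc i))) \<le> d (z i) (q (\<sigma> i)) + d (z i) (q (\<sigma> (Suc i)))"
          using i z(3) \<sigma>M by (intro triangle'') auto
        also have "d (z i) (q (\<sigma> (Suc i))) \<le> d (z i) (z (Suc i)) + d (z (Suc i)) (q (\<sigma> (Suc i)))"
          using i z(3) \<sigma>M by (intro triangle) auto
        finally have "d (q (\<sigma> i)) (q (\<sigma> (Suc i))) \<le> 2 * D0 + 1"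
          using i z(4)[rule_format, of i] \<sigma>z[of i] \<sigma>z[of "Suc i"] by linarith
        then have "\<kappa> * (d (q (\<sigma> i)) (q (\<sigma> (Suc i))) + L) \<le> J"
          unfolding J_def using Q(1) by (intro mult_left_mono) auto
        then show ?thesis using Q(6)[OF \<sigma>I \<sigma>I, of i "Suc i"] i by simp
      qed
      have EJ: "\<kappa> * J + L = E" by (simp add: E J_def D0_def)
      have \<sigma>': "\<forall>i\<le>n. \<sigma> i \<in> I" "\<forall>i<n. \<bar>\<sigma> i - \<sigma> (Suc i)\<bar> \<le> J" and t': "0 \<le> t" "t < 1"
        using \<sigma>I \<sigma>J t by auto
      obtain k l where kl: "k < l" "l \<le> n" "d (q (\<sigma> k)) (q r) \<le> t * l0 + E"
        "d (q (\<sigma> l)) (q r') \<le> t * l0 + E" "\<And>j. k < j \<Longrightarrow> j < l \<Longrightarrow> q (\<sigma> j) \<in> mid"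
        by (rule crosses_t_middle[OF M q r l0[unfolded l0_def] t' \<sigma>'(1) \<sigma>0 \<sigma>'(2) \<open>J \<ge> 0\<close>,
              folded l0_def mid_def, unfolded EJ]) (rule that)
      \<comment> \<open>\<open>z k\<close> and \<open>z l\<close> are within
        \<open>t * l0 + E + D0\<close> of \<open>q r\<close> and \<open>q r'\<close>
        respectively.\<close>
      have "(1 - 2 * t) * l0 - 2 * E - 2 * D0 \<le> d (z k) (z l)"
      proof -
        have "l0 \<le> d (q (\<sigma> k)) (q r) + d (q (\<sigma> k)) (q r')"
          unfolding l0_def using kl r Q(4) \<sigma>M by (intro triangle'') auto
        also have "d (q (\<sigma> k)) (q r') \<le> d (z k) (q (\<sigma> k)) + d (z k) (q r')"
          using kl r Q(4) \<sigma>M z(3) by (intro triangle'') auto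
        also have "d (z k) (q r') \<le> d (z k) (z l) + d (z l) (q r')"
          using kl r Q(4) \<sigma>M z(3) by (intro triangle) auto
        also have "d (z l) (q r') \<le> d (z l) (q (\<sigma> l)) + d (q (\<sigma> l)) (q r')"
          using kl r Q(4) \<sigma>M z(3) by (intro triangle) auto
        finally show ?thesis using kl \<sigma>z[of k] \<sigma>z[of l] by (simp add: algebra_simps)
      qed
      also have "\<dots> \<le> real (l - k)" using walk_dist[OF M z(3,4), of k l] kl by simp
      finally have len: "(1 - 2 * t) * l0 - (2 * E + 2 * D0 + 1) \<le> real (l - Suc k)" using kl(1) by linarith
      \<comment> \<open>Only the points strictly between \<open>z k\<close> and \<open>z l\<close>
        are known to be near the middle; \<open>Suc j\<close> runs over exactly their
        indices.\<close>
      have "K * (l - Suc k) = (\<Sum>j=k..<l - 1. K)" by simp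
      also have "\<dots> = (\<Sum>j=k..<l - 1. \<phi> (z (Suc j)))"
      proof (rule sum.cong)
        fix j assume "j \<in> {k..<l - 1}"
        then have j: "k < Suc j" "Suc j < l" by auto
        then have "z (Suc j) \<in> nbhd M d m mid"
          unfolding nbhd_def using kl(2) kl(5)[OF j] z(3) \<sigma>z[of "Suc j"] m(1) unfolding D0_def
          by (auto intro!: bexI[of _ "q (\<sigma> (Suc j))"])
        then show "K = \<phi> (z (Suc j))" by (simp add: \<phi>_def)
      qed simp
      also have "\<dots> \<le> (\<Sum>j=0..<n. \<phi> (z (Suc j)))" using kl by (intro sum_mono2) auto
      finally have low: "K * (l - Suc k) \<le> (\<Sum>j=0..<n. \<phi> (z (Suc j)))" .
      obtain N w where w: "w 0 = p u" "w N = p v" "\<forall>i\<le>N. w i \<in> p ` {u..v}"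
        "\<forall>i<N. d (w i) (w (Suc i)) \<le> 1" and N: "real N \<le> 2 * (C * l0) + 1"
        using path_unit_walk[OF M p(1,2), of "C * l0"] p(4) C l0 unfolding l0_def
        by (metis less_imp_le mult_pos_pos)
      have w1: "\<forall>i\<le>N. \<phi> (w i) = 1" "\<forall>i\<le>N. w i \<in> M" using w(3) avoid pM by (auto simp: \<phi>_def)
      have "walk_cost M d \<phi> (q r) (q r') N"
      proof (cases "p u = q r \<and> p v = q r'")
        case True
        then show ?thesis using walk_cost_of_cheap_walk[OF w1(2) w(4) w1(1)] w(1,2) by simp
      next
        case False
        \<comment> \<open>Here \<open>p\<close> runs from \<open>q r'\<close> to \<open>q r\<close>,
          so the walk is read backwards.\<close>
        have "d (w (N - i)) (w (N - Suc i)) \<le> 1" if "i < N" for i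
          using w(4)[rule_format, of "N - Suc i"] that by (simp add: Suc_diff_Suc commute)
        then have "walk_cost M d \<phi> (w (N - 0)) (w (N - N)) N"
          using w1 by (intro walk_cost_of_cheap_walk) auto
        then show ?thesis using False p(3) w(1,2) by auto
      qed
      from opt[OF this] low have "K * (l - Suc k) \<le> N" by linarith
      then have "real K * real (l - Suc k) \<le> 2 * (C * l0) + 1"
        using N by (metis of_nat_le_iff of_nat_mult order_trans)
      moreover have "real K * ((1 - 2 * t) * l0 - (2 * E + 2 * D0 + 1)) \<le> real K * real (l - Suc k)"
        using len by (intro mult_left_mono) auto
      \<comment> \<open>The heavy stretch costs at least \<open>3 * C * l0\<close> up to a constant,
        the light walk at most \<open>2 * C * l0 + 1\<close>. The surplus \<open>C * l0\<close> is
        therefore bounded.\<close>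
      moreover have "3 * C * l0 \<le> real K * (1 - 2 * t) * l0" using K(1) l0 by (intro mult_right_mono) auto
      ultimately have "C * l0 \<le> real K * (2 * E + 2 * D0 + 1) + 1" by (simp add: algebra_simps)
      then have "l0 \<le> B" using C by (simp add: B D0_def pos_le_divide_eq mult.commute)
      then show False using far by simp
    qed
  qed
qed

text \<open>For \<open>t < 1/2\<close>, \<open>K\<close> is the least natural number with
  \<open>3 * C \<le> K * (1 - 2 * t)\<close>. \<open>E\<close> and \<open>B\<close> are the
  constants of \<open>stable_path_meets_middle\<close>, and the maximum collects its two
  requirements on \<open>m\<close>. The entry 1 makes the value positive for every
  \<open>C\<close>.\<close>

definition recurrence_bound ::
  "(real \<Rightarrow> real \<Rightarrow> real) \<Rightarrow> real \<Rightarrow> real \<Rightarrow> real \<Rightarrow> real \<Rightarrow> real" where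
  "recurrence_bound D \<kappa> L t C =
    (let K = real (nat \<lceil>3 * C / (1 - 2 * t)\<rceil>);
         E = \<kappa> * (\<kappa> * (2 * D K 2 + 1 + L)) + L;
         B = (K * (2 * E + 2 * D K 2 + 1) + 1) / C
     in max 1 (max (D K 2) (\<kappa> * (\<kappa> * (B + L)) + L)))"

lemma stable_imp_recurrent:
  assumes "geodesic_space M d" "quasigeodesic M d \<kappa> L I q" "continuous_path M d I q"
    "stable_with M d D I q" and t: "0 < t" "t < 1/2"
  shows "recurrent_with M d t (recurrence_bound D \<kappa> L t) I q"
proof -
  have *: "p ` {u..v} \<inter> nbhd M d (recurrence_bound D \<kappa> L t C) (t_middle d I q t (q r) (q r')) \<noteq> {}"
    if C: "C > 0" and p: "u \<le> v" "continuous_path M d {u..v} p"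
      "(p u = q r \<and> p v = q r') \<or> (p u = q r' \<and> p v = q r)"
      "arclength d u v p \<le> ennreal (C * d (q r) (q r'))"
      and r: "r \<in> I" "r' \<in> I" "r \<le> r'" for C u v p r r'
  proof -
    define K where "K = nat \<lceil>3 * C / (1 - 2 * t)\<rceil>"
    have pos: "3 * C / (1 - 2 * t) > 0" using C t by simp
    then have K: "3 * C / (1 - 2 * t) \<le> real K" "K \<ge> 1" unfolding K_def by linarith+
    then have "3 * C \<le> real K * (1 - 2 * t)" using t by (simp add: pos_divide_le_eq)
    then show ?thesis
      by (rule stable_path_meets_middle[OF assms(1-6) C _ K(2) refl refl _ _ r p(2,1,3,4)])
        (simp_all only: recurrence_bound_def Let_def K_def le_max_iff_disj order_refl simp_thms)
  qed
  show ?thesis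
    unfolding recurrent_with_def
  proof (intro conjI allI impI)
    show "recurrence_bound D \<kappa> L t C > 0" for C
      unfolding recurrence_bound_def Let_def by (rule less_le_trans[OF zero_less_one max.cobounded1])
  next
    fix C p u v a b
    assume p: "C > 0" "u \<le> v" "continuous_path M d {u..v} p" "p u = a \<and> p v = b \<or> p u = b \<and> p v = a"
      "arclength d u v p \<le> ennreal (C * d a b)"
    assume "\<exists>s\<in>I. \<exists>s'\<in>I. s \<le> s' \<and> q s = a \<and> q s' = b"
    then obtain r r' where r: "r \<in> I" "r' \<in> I" "r \<le> r'" "a = q r" "b = q r'" by blast
    show "p ` {u..v} \<inter> nbhd M d (recurrence_bound D \<kappa> L t C) (t_middle d I q t a b) \<noteq> {}"
      using *[OF p[unfolded r(4,5)] r(1-3)] unfolding r(4,5) .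
  qed
qed

subsection \<open>Middle recurrent quasigeodesics are stable\<close>

text \<open>The middle refers to the orientation of \<open>q\<close>, whereas its two distance
  conditions are symmetric in the endpoints. Keeping only these lets \<open>p\<close> run from
  \<open>a\<close> to \<open>b\<close> in whichever order they occur along \<open>q\<close>.\<close>

lemma recurrent_withD:
  assumes "recurrent_with M d t m I q" "C > 0" "u \<le> v" "continuous_path M d {u..v} p"
    and M: "Metric_space M d" and ab: "a \<in> q ` I" "b \<in> q ` I" "p u = a" "p v = b"
    and len: "arclength d u v p \<le> ennreal (C * d a b)"
  obtains s y where "s \<in> {u..v}" "y \<in> q ` I" "d (p s) y \<le> m C"
    "t * d a b \<le> d y a" "t * d a b \<le> d y b"
proof -
  interpret Metric_space M d by fact
  have "\<exists>s y. s \<in> {u..v} \<and> y \<in> q ` I \<and> d (p s) y \<le> m C \<and> t * d a b \<le> d y a' \<and> t * d a b \<le> d y b'"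
    if o: "(p u = a' \<and> p v = b') \<or> (p u = b' \<and> p v = a')" "\<exists>s\<in>I. \<exists>s'\<in>I. s \<le> s' \<and> q s = a' \<and> q s' = b'"
      and "d a b = d a' b'" for a' b'
  proof -
    have "p ` {u..v} \<inter> nbhd M d (m C) (t_middle d I q t a' b') \<noteq> {}"
      using assms(1)[unfolded recurrent_with_def, THEN conjunct2, rule_format, OF assms(2-4) o]
        len that(3) by simp
    then show ?thesis using that(3) unfolding nbhd_def t_middle_def by auto
  qed
  note * = this[of a b] this[of b a]
  obtain s s' where s: "s \<in> I" "s' \<in> I" "q s = a" "q s' = b" using ab by blast
  have "\<exists>s y. s \<in> {u..v} \<and> y \<in> q ` I \<and> d (p s) y \<le> m C \<and> t * d a b \<le> d y a \<and> t * d a b \<le> d y b"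
  proof (cases "s \<le> s'")
    case True
    then show ?thesis using *(1) s ab by blast
  next
    case False
    then have "s' \<le> s" by simp
    then show ?thesis using *(2) s ab commute[of a b] by blast
  qed
  then show thesis using that by blast
qed

text \<open>The path through \<open>a\<close>, the walk and \<open>b\<close> can meet the \<open>m C\<close>-neighbourhood of the middle only on its
  first or last segment.\<close>

lemma excursion_bound:
  assumes geo: "geodesic_space M d" and rec: "recurrent_with M d t m I q" and qM: "q ` I \<subseteq> M"
    and C: "C > 0"
    and x: "\<forall>k\<le>N. x k \<in> M" "\<forall>k<N. d (x k) (x (Suc k)) \<le> c" and N: "N \<ge> 2"
    and a: "a \<in> q ` I" "d a (x 0) \<le> r" and b: "b \<in> q ` I" "d (x N) b \<le> r"
    and r: "r = m C + c"
    and away: "\<And>k y. 0 < k \<Longrightarrow> k < N \<Longrightarrow> y \<in> q ` I \<Longrightarrow> d (x k) y > r"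
    and len: "real N * c + 2 * r \<le> C * d a b"
  shows "t * d a b \<le> m C + r"
proof -
  have M: "Metric_space M d" using geo by (simp add: geodesic_space_def)
  interpret Metric_space M d by fact
  define X where "X k = (if k = 0 then a else if k \<le> Suc N then x (k - 1) else b)" for k
  define T where "T = (\<Sum>k<Suc (Suc N). d (X k) (X (Suc k)))"
  have abM: "a \<in> M" "b \<in> M" using a b qM by auto
  have X: "\<forall>k\<le>Suc (Suc N). X k \<in> M" using x(1) abM by (auto simp: X_def)
  have "T = d a (x 0) + (\<Sum>k<N. d (x k) (x (Suc k))) + d (x N) b"
    unfolding T_def by (subst sum.lessThan_Suc, subst sum.lessThan_Suc_shift) (simp add: X_def)
  also have "(\<Sum>k<N. d (x k) (x (Suc k))) \<le> real N * c"
    using sum_bounded_above[of "{..<N}" "\<lambda>k. d (x k) (x (Suc k))" c] x(2) by simp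
  finally have T: "T \<le> C * d a b" using a b len by linarith
  have T0: "T \<ge> 0" unfolding T_def by (simp add: sum_nonneg)
  obtain p where p: "p ` {0..T} \<subseteq> M" "p 0 = X 0" "p T = X (Suc (Suc N))"
    "\<forall>s\<in>{0..T}. \<forall>s'\<in>{0..T}. d (p s) (p s') \<le> \<bar>s - s'\<bar>"
    "\<forall>s\<in>{0..T}. p s = X 0 \<or>
       (\<exists>k<Suc (Suc N). d (X k) (p s) + d (p s) (X (Suc k)) = d (X k) (X (Suc k)))"
    using piecewise_geodesic[OF geo X T_def] by (elim exE conjE)
  have pab: "p 0 = a" "p T = b" using p(2,3) by (simp_all add: X_def)
  note lip = lipschitz_path[OF M T0 p(1) p(4)[rule_format]]
  have "arclength d 0 T p \<le> ennreal (C * d a b)"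
    using lip(2) T by (simp add: order_trans[OF _ ennreal_leI])
  then obtain s y where s: "s \<in> {0..T}" and y: "y \<in> q ` I" "d (p s) y \<le> m C"
    "t * d a b \<le> d y a" "t * d a b \<le> d y b"
    using recurrent_withD[OF rec C T0 lip(1) M a(1) b(1) pab] by blast
  have ps: "p s \<in> M" and yM: "y \<in> M" using p(1) s y(1) qM by auto
  have r0: "r \<ge> 0" using order_trans[OF nonneg a(2)] .
  \<comment> \<open>The first and last segments have length at most \<open>r\<close>, so a point on
    them is within \<open>r\<close> of \<open>a\<close> or \<open>b\<close>. On any other segment it
    is within \<open>c\<close> of both vertices.\<close>
  consider (ends) "d (p s) a \<le> r \<or> d (p s) b \<le> r"
    | (inner) k where "k < N" "d (x k) (p s) \<le> c" "d (x (Suc k)) (p s) \<le> c"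
  proof -
    consider "p s = a" | k where "k < Suc (Suc N)"
        "d (X k) (p s) + d (p s) (X (Suc k)) = d (X k) (X (Suc k))"
      using p(5)[rule_format, OF s] pab(1) p(2) by metis
    then show thesis
    proof cases
      case 1
      then show thesis using ends abM r0 by simp
    next
      case (2 k)
      have le: "d (X k) (p s) \<le> d (X k) (X (Suc k))" "d (X (Suc k)) (p s) \<le> d (X k) (X (Suc k))"
        using 2(2) nonneg[of "X k" "p s"] nonneg[of "p s" "X (Suc k)"] commute[of "p s" "X (Suc k)"]
        by linarith+
      consider "k = 0" | "k = Suc N" | j where "k = Suc j" "j < N"
        using 2(1) by (metis less_Suc_eq not0_implies_Suc Suc_less_eq)
      then show thesis
      proof cases
        case 1
        then show thesis using ends le a by (simp add: X_def commute)
      next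
        case 2
        then show thesis using ends le b by (simp add: X_def commute)
      next
        case (3 j)
        then show thesis using inner[of j] le x(2) by (fastforce simp: X_def)
      qed
    qed
  qed
  then show ?thesis
  proof cases
    case ends
    have "d y a \<le> d (p s) y + d (p s) a" "d y b \<le> d (p s) y + d (p s) b"
      using ps yM abM by (auto intro: triangle'')
    then show ?thesis using ends y by linarith
  next
    case (inner k)
    \<comment> \<open>Since \<open>N \<ge> 2\<close>, each segment of the walk has a vertex other
      than \<open>x 0\<close> and \<open>x N\<close>. It would be within \<open>c + m C = r\<close>
      of \<open>y\<close>, against \<open>away\<close>.\<close>
    define j where "j = (if k = 0 then 1 else k)"
    have j: "0 < j" "j < N" "d (x j) (p s) \<le> c" using inner N by (auto simp: j_def)
    have "d (x j) y \<le> d (x j) (p s) + d (p s) y" using ps yM x(1) j by (intro triangle) auto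
    then show ?thesis using away[OF j(1,2) y(1)] j(3) y(2) r by linarith
  qed
qed

text \<open>An excursion of \<open>N\<close> unit parameter steps has length at most
  \<open>N * c\<close>, and its ends are about \<open>N / \<kappa>\<close> or more apart. The ratio
  is thus about \<open>\<kappa> * c\<close>, and doubling it in \<open>C\<close> leaves room for
  additive constants. The arguments of the inner maximum are thresholds for \<open>N\<close>: beyond
  the first the comparison path is short enough for recurrence with \<open>C\<close>, beyond the
  second its endpoints are too far apart for \<open>excursion_bound\<close>. The outer maximum makes
  the value nonnegative for all arguments.\<close>

definition stability_bound :: "(real \<Rightarrow> real) \<Rightarrow> real \<Rightarrow> real \<Rightarrow> real \<Rightarrow> real" where
  "stability_bound m t \<kappa> L =
    (let c = \<kappa> + L; C = 2 * \<kappa> * c + 1; r = m C + c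
     in max 0 (r + c * (max ((2 * r + C * (1 + L + 2 * r)) / c)
          (\<kappa> * ((m C + r) / t + L + 2 * r) + 1) + 1)))"

text \<open>\<open>\<eta>\<close> may jump, so it is replaced by samples one parameter unit apart.
  Around a sample farther than \<open>r\<close> from \<open>q\<close>, the maximal run of such
  samples forms an excursion as in \<open>excursion_bound\<close>. This bounds its number of steps,
  and hence the distance back to the last sample close to \<open>q\<close>.\<close>

lemma recurrent_imp_stable:
  assumes geo: "geodesic_space M d" and qM: "q ` I \<subseteq> M"
    and rec: "recurrent_with M d t m I q" and t: "t > 0"
  shows "stable_with M d (stability_bound m t) I q"
  unfolding stable_with_def
proof (intro conjI allI impI subsetI)
  show "stability_bound m t \<kappa> L \<ge> 0" for \<kappa> L
    unfolding stability_bound_def Let_def by (rule max.cobounded1)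
next
  fix \<kappa> L u v \<eta> w
  assume uv: "u \<le> v" and \<eta>: "quasigeodesic M d \<kappa> L {u..v} \<eta>"
    and ends: "\<eta> u \<in> q ` I" "\<eta> v \<in> q ` I" and w: "w \<in> \<eta> ` {u..v}"
  have M: "Metric_space M d" using geo by (simp add: geodesic_space_def)
  interpret Metric_space M d by fact
  note Q = quasigeodesicD[OF \<eta>]
  define c where "c = \<kappa> + L"
  define C where "C = 2 * \<kappa> * c + 1"
  define r where "r = m C + c"
  define N0 where "N0 = (2 * r + C * (1 + L + 2 * r)) / c"
  define N1 where "N1 = \<kappa> * ((m C + r) / t + L + 2 * r) + 1"
  have c0: "c > 0" using Q(1,2) by (simp add: c_def)
  then have "C > 0" using Q(1) by (simp add: C_def add_pos_pos)
  then have "m C > 0" using rec by (simp add: recurrent_with_def)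
  then have "r > 0" and "r \<ge> 0" using c0 by (auto simp: r_def)
  have N1: "N1 \<ge> 0" using Q(1,2) \<open>m C > 0\<close> \<open>r > 0\<close> t by (simp add: N1_def)
  obtain z where z: "z \<in> {u..v}" "w = \<eta> z" using w by blast
  define n where "n = nat \<lceil>v - u\<rceil>"
  \<comment> \<open>Capping at \<open>v\<close> gives \<open>s n = v\<close>; the last step may be
    shorter than 1.\<close>
  define s where "s i = min (u + real i) v" for i
  define x where "x i = \<eta> (s i)" for i
  have n: "v - u \<le> real n" "n > 0 \<Longrightarrow> real n < v - u + 1" using uv unfolding n_def by linarith+
  have s: "s i \<in> {u..v}" for i using uv by (auto simp: s_def)
  have xM: "x i \<in> M" for i using Q(4) s by (simp add: x_def)
  have step: "d (\<eta> y) (\<eta> y') \<le> c" if "y \<in> {u..v}" "y' \<in> {u..v}" "\<bar>y - y'\<bar> \<le> 1" for y y'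
  proof -
    have "d (\<eta> y) (\<eta> y') \<le> \<kappa> * \<bar>y - y'\<bar> + L" using Q(5) that by blast
    also have "\<kappa> * \<bar>y - y'\<bar> \<le> \<kappa> * 1" using Q(1) that by (intro mult_left_mono) auto
    finally show ?thesis by (simp add: c_def)
  qed
  have xstep: "d (x i) (x (Suc i)) \<le> c" for i
    unfolding x_def by (intro step s) (auto simp: s_def)
  have "s 0 = u" "s n = v" using uv n(1) by (simp_all add: s_def)
  then have x_end: "x 0 = \<eta> u" "x n = \<eta> v" by (simp_all add: x_def)
  define k where "k = nat \<lfloor>z - u\<rfloor>"
  have k: "real k \<le> z - u" "z - u < real k + 1" using z(1) by (auto simp: k_def)
  have "real k \<le> real n" using k n z by simp
  then have "k \<le> n" by simp
  have "d w (x k) \<le> c" unfolding z(2) x_def by (intro step z s) (use k z in \<open>auto simp: s_def\<close>)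
  define P where "P i \<longleftrightarrow> (\<exists>y\<in>q ` I. d (x i) y \<le> r)" for i
  have "P i" if "x i \<in> q ` I" for i
    unfolding P_def using that mdist_zero[OF xM] \<open>r \<ge> 0\<close> by (intro bexI[of _ "x i"]) simp_all
  then have P: "P 0" "P n" using ends x_end by simp_all
  have "\<exists>y\<in>q ` I. d (x k) y \<le> r + c * max N0 N1"
  proof (cases "P k")
    case True
    moreover have "0 \<le> c * max N0 N1" using N1 c0 by (simp add: le_max_iff_disj)
    ultimately show ?thesis unfolding P_def by (meson add_increasing2 order_trans order_refl)
  next
    case False
    obtain i where i: "i < k" "P i" and i': "\<And>j. i < j \<Longrightarrow> j \<le> k \<Longrightarrow> \<not> P j"
      using last_before[of P 0 k] P(1) False by auto
    have "k < n" using \<open>k \<le> n\<close> False P(2) by (cases "k = n") auto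
    then obtain j where j: "k < j" "j \<le> n" "P j" and j': "\<And>l. k < l \<Longrightarrow> l < j \<Longrightarrow> \<not> P l"
      using first_after[of P n k] P(2) by blast
    have away: "\<not> P l" if "i < l" "l < j" for l using i'[of l] j'[of l] that by (cases "l \<le> k") auto
    obtain a where a: "a \<in> q ` I" "d (x i) a \<le> r" using i(2) by (auto simp: P_def)
    obtain b where b: "b \<in> q ` I" "d (x j) b \<le> r" using j(3) by (auto simp: P_def)
    have abM: "a \<in> M" "b \<in> M" using a b qM by auto
    define N where "N = j - i"
    have N: "N \<ge> 2" "i + N = j" using i j by (auto simp: N_def)
    have "real N \<le> max N0 N1"
    proof (rule ccontr)
      assume "\<not> real N \<le> max N0 N1"
      then have big: "N0 < real N" "N1 < real N" by auto
      \<comment> \<open>Up to index \<open>n\<close>, only the last step can be shorter than 1,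
        which accounts for \<open>real N - 1\<close>.\<close>
      have far: "(real N - 1) / \<kappa> - L - 2 * r \<le> d a b"
      proof -
        have "n > 0" using j by simp
        moreover have "real j \<le> real n" using j(2) by simp
        ultimately have "u + real j - 1 \<le> s j" using n(2) by (simp add: s_def)
        moreover have "s i \<le> u + real i" by (simp add: s_def)
        moreover have "real j = real i + real N" using N(2) by linarith
        ultimately have "real N - 1 \<le> \<bar>s i - s j\<bar>" by linarith
        also have "\<dots> \<le> \<kappa> * (d (x i) (x j) + L)" unfolding x_def by (intro Q(6) s)
        finally have "(real N - 1) / \<kappa> \<le> d (x i) (x j) + L" using Q(1) by (simp add: pos_divide_le_eq mult.commute)
        moreover have "d (x i) (x j) \<le> d (x i) a + d a (x j)" "d a (x j) \<le> d a b + d (x j) b"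
          using xM abM by (auto intro: triangle triangle')
        ultimately show ?thesis using a b by linarith
      qed
      \<comment> \<open>\<open>C * ((real N - 1) / \<kappa>)\<close> is at least
        \<open>2 * c * (real N - 1)\<close>. One copy of \<open>real N * c\<close> pays for the
        walk, the other for all constants, because \<open>N0 < real N\<close>.\<close>
      have len: "real N * c + 2 * r \<le> C * d a b"
      proof -
        have "2 * r + C * (1 + L + 2 * r) \<le> real N * c"
          using big(1) c0 by (simp add: N0_def pos_divide_less_eq)
        moreover have "2 * c * (real N - 1) \<le> C * ((real N - 1) / \<kappa>)"
        proof -
          have "2 * c * \<kappa> * (real N - 1) \<le> C * (real N - 1)"
            using N(1) by (intro mult_right_mono) (auto simp: C_def)
          then show ?thesis using Q(1) by (simp add: pos_le_divide_eq mult_ac)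
        qed
        moreover have "2 * c * 1 \<le> 2 * c * \<kappa>" using Q(1) c0 by (intro mult_left_mono) auto
        moreover have "2 * c * \<kappa> + 1 = C" by (simp add: C_def)
        moreover have "C * ((real N - 1) / \<kappa> - L - 2 * r) \<le> C * d a b"
          using far \<open>C > 0\<close> by (intro mult_left_mono) auto
        ultimately show ?thesis by (simp add: algebra_simps)
      qed
      have "t * d a b \<le> m C + r"
      proof (rule excursion_bound[OF geo rec qM \<open>C > 0\<close> _ _ N(1) a(1) _ b(1) _ r_def _ len])
        show "r < d (x (i + l)) y" if "0 < l" "l < N" "y \<in> q ` I" for l y
          using away[of "i + l"] that N(2) unfolding P_def by force
        show "d a (x (i + 0)) \<le> r" "d (x (i + N)) b \<le> r" using a(2) b(2) N(2) by (simp_all add: commute[of a])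
      qed (use xM xstep in simp_all)
      then have "d a b \<le> (m C + r) / t" using t by (simp add: pos_le_divide_eq mult.commute)
      then have "(real N - 1) / \<kappa> \<le> (m C + r) / t + L + 2 * r" using far by linarith
      then have "real N \<le> N1" using Q(1) by (simp add: N1_def pos_divide_le_eq mult.commute)
      then show False using big(2) by simp
    qed
    then have "c * real (k - i) \<le> c * max N0 N1"
      using c0 j(1) by (intro mult_left_mono) (auto simp: N_def)
    moreover have "d (x i) (x k) \<le> c * real (k - i)"
      using walk_dist[OF M, of k x c i k] xM xstep i(1) by simp
    moreover have "d (x k) a \<le> d (x i) (x k) + d (x i) a" using xM abM by (intro triangle'') auto
    ultimately have "d (x k) a \<le> r + c * max N0 N1" using a(2) by linarith
    then show ?thesis using a(1) by blast
  qed
  then obtain y where y: "y \<in> q ` I" "d (x k) y \<le> r + c * max N0 N1" by blast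
  have wM: "w \<in> M" using z Q(4) by simp
  have "d w y \<le> d w (x k) + d (x k) y" using wM xM y(1) qM by (intro triangle) auto
  also have "\<dots> \<le> r + c * (max N0 N1 + 1)" using y(2) \<open>d w (x k) \<le> c\<close> by (simp add: distrib_left)
  also have "\<dots> \<le> stability_bound m t \<kappa> L"
    unfolding stability_bound_def Let_def c_def[symmetric] C_def[symmetric] r_def[symmetric]
      N0_def[symmetric] N1_def[symmetric] by simp
  finally show "w \<in> nbhd M d (stability_bound m t \<kappa> L) (q ` I)"
    unfolding nbhd_def using wM y(1) by blast
qed

section \<open>The equivalence and the uniform bounds\<close>

theorem theorem1p2:
  shows
   "(\<forall>(M::'a set) d I q.
       geodesic_space M d \<longrightarrow> is_quasigeodesic M d I q \<longrightarrow> continuous_path M d I q \<longrightarrow>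
       (stable_quasigeodesic M d I q \<longleftrightarrow> middle_recurrent M d I q))
    \<and>
    (\<forall>D \<kappa> L. \<exists>m. \<forall>(M::'a set) d I q.
       geodesic_space M d \<longrightarrow> quasigeodesic M d \<kappa> L I q \<longrightarrow> continuous_path M d I q \<longrightarrow>
       stable_with M d D I q \<longrightarrow>
       (\<forall>t\<in>{0<..<1/2}. recurrent_with M d t (m t) I q))
    \<and>
    (\<forall>m. \<exists>D. \<forall>(M::'a set) d I q.
       geodesic_space M d \<longrightarrow> is_quasigeodesic M d I q \<longrightarrow>
       (\<forall>t\<in>{0<..<1/2}. recurrent_with M d t (m t) I q) \<longrightarrow>
       stable_with M d D I q)"
proof (intro conjI allI)
  have rec: "recurrent_with M d t (recurrence_bound D \<kappa> L t) I q"
    if "geodesic_space M d" "quasigeodesic M d \<kappa> L I q" "continuous_path M d I q"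
      "stable_with M d D I q" "t \<in> {0<..<1/2}" for M :: "'a set" and d I q D \<kappa> L t
    using stable_imp_recurrent[OF that(1-4)] that(5) by simp
  \<comment> \<open>\<open>1/4\<close> stands for an arbitrary value in the open interval from 0 to
    \<open>1/2\<close>.\<close>
  have stab: "stable_with M d (stability_bound m (1/4)) I q"
    if "geodesic_space M d" "is_quasigeodesic M d I q" "recurrent_with M d (1/4) m I q"
    for M :: "'a set" and d I q m
    using that unfolding is_quasigeodesic_def quasigeodesic_def
    by (intro recurrent_imp_stable) auto
  show "geodesic_space M d \<longrightarrow> is_quasigeodesic M d I q \<longrightarrow> continuous_path M d I q \<longrightarrow>
    (stable_quasigeodesic M d I q \<longleftrightarrow> middle_recurrent M d I q)" for M :: "'a set" and d I q
  proof (intro impI iffI)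
    assume *: "geodesic_space M d" "is_quasigeodesic M d I q" "continuous_path M d I q"
    show "middle_recurrent M d I q" if "stable_quasigeodesic M d I q"
      using that * rec
      unfolding middle_recurrent_def t_middle_recurrent_def stable_quasigeodesic_def is_quasigeodesic_def
      by blast
    show "stable_quasigeodesic M d I q" if mr: "middle_recurrent M d I q"
    proof -
      have "(1/4::real) \<in> {0<..<1/2}" by simp
      then obtain m where "recurrent_with M d (1/4) m I q"
        using mr unfolding middle_recurrent_def t_middle_recurrent_def by blast
      then show ?thesis using stab[OF *(1,2)] unfolding stable_quasigeodesic_def by blast
    qed
  qed
  show "\<exists>m. \<forall>(M::'a set) d I q.
       geodesic_space M d \<longrightarrow> quasigeodesic M d \<kappa> L I q \<longrightarrow> continuous_path M d I q \<longrightarrow>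
       stable_with M d D I q \<longrightarrow> (\<forall>t\<in>{0<..<1/2}. recurrent_with M d t (m t) I q)" for D \<kappa> L
    \<comment> \<open>The witness is built from \<open>D\<close>, \<open>\<kappa>\<close> and
      \<open>L\<close> before any space is chosen, which is the uniformity asked for.\<close>
    using rec by (intro exI[of _ "recurrence_bound D \<kappa> L"]) blast
  show "\<exists>D. \<forall>(M::'a set) d I q.
       geodesic_space M d \<longrightarrow> is_quasigeodesic M d I q \<longrightarrow>
       (\<forall>t\<in>{0<..<1/2}. recurrent_with M d t (m t) I q) \<longrightarrow> stable_with M d D I q" for m
    using stab by (intro exI[of _ "stability_bound (m (1/4)) (1/4)"]) simp
qed

end
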